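(* Let $\mu=(\mu_1\ge\cdots\ge\mu_n\ge 0)$ be a partition with $n\ge 1$ (possibly zero) parts. Then there exist bijections between the following four finite sets: 1. the set of Case 1 sequences of partitions with final partition $\mu$ and $\ell=2n$; 2. the set of super symplectic semistandard tableaux of shape $\mu$ with all entries less than $\overline{n}$ (i.e. with entries in $1<\overline{1}<2<\overline{2}<\cdots<\overline{n-1}<n$); 3. the set of $n$-tuples $(p_1,\ldots,p_n)$ of pairwise non-intersecting Delannoy paths, where $p_i$ starts at $(-i,i)$ and ends at $(\mu_i-i,n)$ for $1\le i\le n$; 4. the set of domino tilings of the generalized Aztec triangle of type 1 corresponding to $\mu$.
   Context: For partitions $\lambda\supseteq\nu$, the skew diagram $\lambda/\nu$ is the set of boxes of the Young diagram of $\lambda$ not in that of $\nu$; it is a horizontal strip if it has at most one box in each column, a vertical strip if it has at most one box in each row. Case 1 sequences ($\ell=2n$): sequences of partitions $\lambda^{(0)},\ldots,\lambda^{(\ell-1)}$ such that (1) $\lambda^{(0)}$ is empty; (2) $\lambda^{(\ell-1)}=\mu$; (3) $\lambda^{(2i+1)}/\lambda^{(2i)}$ is a horizontal strip (in particular $\lambda^{(2i)}\subseteq\lambda^{(2i+1)}$); (4) $\lambda^{(2i)}/\lambda^{(2i-1)}$ is a vertical strip (in particular $\lambda^{(2i-1)}\subseteq\lambda^{(2i)}$); (5) $\lambda^{(i)}$ has at most $\lceil i/2\rceil$ nonzero parts; conditions (3)–(5) are required for all indices in range. A super symplectic semistandard tableau of shape $\mu$ is a filling of the boxes of the Young diagram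 of $\mu$ (rows left-justified, row 1 on top with $\mu_1$ boxes) with entries from $1<\overline{1}<2<\overline{2}<\cdots$ such that: (1) rows and columns are weakly increasing; (2) for all $i$, the entries $i$ form a horizontal strip (at most one $i$ in each column); (3) for all $i$, the entries $\overline{i}$ form a vertical strip (at most one $\overline{i}$ in each row); (4) $i$ and $\overline{i}$ do not appear below the $i$th row. A Delannoy path is a lattice path in $\mathbb{Z}^2$ with steps $(1,0)$ (east), $(0,1)$ (north), $(1,1)$ (northeast). Paths are non-intersecting if no two of them share a lattice point. A domino is the union of two unit squares (with vertices in $\mathbb{Z}^2$) sharing an edge; a domino tiling of a finite union $D$ of unit squares is a set of dominoes with pairwise disjoint interiors whose union is $D$. For integers $c,d\ge0$ let $Q(c,d)=[c,c+1]\times[c-d,c-d+1]$ (a square of diagonal $d$). Put $P=\{\mu_j+n-j:1\le j\le n\}\subseteq\{0,\ldots,\mu_1+n-1\}$. The generalized Aztec triangle of type 1 corresponding to $\mu$ is the union of all squares $Q(c,d)$ with $0\le d\le 2n-2$ and $0\le c<\mu_1+\lceil d/2\rceil$, together with the squares $Q(c,2n-1)$ for $c\in\{0,\ldots,\mu_1+n-1\}\setminus P$. *)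

theory Defs
  imports "HOL-Analysis.Analysis" "HOL-Library.FuncSet"
begin

text \<open>A partition is the function sending \<open>i \<ge> 1\<close> to its \<open>i\<close>-th part, with trailing zeros. There is
  no part number \<open>0\<close>; the value there is pinned to \<open>0\<close> so that equality of functions is equality of
  partitions.\<close>

definition is_partition :: "(nat \<Rightarrow> nat) \<Rightarrow> bool" where
  "is_partition \<nu> \<longleftrightarrow>
     \<nu> 0 = 0 \<and> (\<forall>i j. 1 \<le> i \<longrightarrow> i \<le> j \<longrightarrow> \<nu> j \<le> \<nu> i) \<and> finite {i. \<nu> i \<noteq> 0}"

definition num_parts :: "(nat \<Rightarrow> nat) \<Rightarrow> nat" where
  "num_parts \<nu> = card {i. \<nu> i \<noteq> 0}"

text \<open>Boxes are pairs (row, column), both counted from \<open>1\<close>.\<close>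

definition young :: "(nat \<Rightarrow> nat) \<Rightarrow> (nat \<times> nat) set" where
  "young \<nu> = {(i, j). 1 \<le> i \<and> 1 \<le> j \<and> j \<le> \<nu> i}"

definition horizontal_strip :: "(nat \<times> nat) set \<Rightarrow> bool" where
  "horizontal_strip S \<longleftrightarrow> (\<forall>i i' j. (i, j) \<in> S \<longrightarrow> (i', j) \<in> S \<longrightarrow> i = i')"

definition vertical_strip :: "(nat \<times> nat) set \<Rightarrow> bool" where
  "vertical_strip S \<longleftrightarrow> (\<forall>i j j'. (i, j) \<in> S \<longrightarrow> (i, j') \<in> S \<longrightarrow> j = j')"

definition case1_sequences :: "nat \<Rightarrow> (nat \<Rightarrow> nat) \<Rightarrow> (nat \<Rightarrow> nat \<Rightarrow> nat) set" where
  "case1_sequences l \<mu> =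
     {\<Lambda> \<in> {0..<l} \<rightarrow>\<^sub>E {\<nu>. is_partition \<nu>}.
        \<Lambda> 0 = (\<lambda>_. 0) \<and>
        \<Lambda> (l - 1) = \<mu> \<and>
        (\<forall>i. 2 * i + 1 < l \<longrightarrow>
           young (\<Lambda> (2 * i)) \<subseteq> young (\<Lambda> (2 * i + 1)) \<and>
           horizontal_strip (young (\<Lambda> (2 * i + 1)) - young (\<Lambda> (2 * i)))) \<and>
        (\<forall>i. 1 \<le> i \<longrightarrow> 2 * i < l \<longrightarrow>
           young (\<Lambda> (2 * i - 1)) \<subseteq> young (\<Lambda> (2 * i)) \<and>
           vertical_strip (young (\<Lambda> (2 * i)) - young (\<Lambda> (2 * i - 1)))) \<and>
        (\<forall>i<l. int (num_parts (\<Lambda> i)) \<le> \<lceil>real i / 2\<rceil>)}"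

datatype letter = Plain nat | Barred nat

text \<open>The rank induces the order \<open>1 < \<close>bar\<open> 1 < 2 < \<close>bar\<open> 2 < \<dots>\<close>.\<close>

fun letter_rank :: "letter \<Rightarrow> nat" where
  "letter_rank (Plain i) = 2 * i"
| "letter_rank (Barred i) = 2 * i + 1"

lemma letter_rank_inject: "letter_rank a = letter_rank b \<longleftrightarrow> a = b"
  by (cases a; cases b) (auto, presburger+)

instantiation letter :: linorder
begin

definition less_eq_letter :: "letter \<Rightarrow> letter \<Rightarrow> bool" where
  "a \<le> b \<longleftrightarrow> letter_rank a \<le> letter_rank b"

definition less_letter :: "letter \<Rightarrow> letter \<Rightarrow> bool" where
  "a < b \<longleftrightarrow> letter_rank a < letter_rank b"

instance
  by standard (auto simp: less_eq_letter_def less_letter_def letter_rank_inject[symmetric])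

end

definition letters :: "letter set" where
  "letters = {Plain i |i. 1 \<le> i} \<union> {Barred i |i. 1 \<le> i}"

definition super_symplectic_tableaux :: "(nat \<Rightarrow> nat) \<Rightarrow> (nat \<times> nat \<Rightarrow> letter) set" where
  "super_symplectic_tableaux \<mu> =
     {T \<in> young \<mu> \<rightarrow>\<^sub>E letters.
        (\<forall>i j j'. (i, j) \<in> young \<mu> \<longrightarrow> (i, j') \<in> young \<mu> \<longrightarrow> j \<le> j' \<longrightarrow> T (i, j) \<le> T (i, j')) \<and>
        (\<forall>i i' j. (i, j) \<in> young \<mu> \<longrightarrow> (i', j) \<in> young \<mu> \<longrightarrow> i \<le> i' \<longrightarrow> T (i, j) \<le> T (i', j)) \<and>
        (\<forall>k. horizontal_strip {b \<in> young \<mu>. T b = Plain k}) \<and>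
        (\<forall>k. vertical_strip {b \<in> young \<mu>. T b = Barred k}) \<and>
        (\<forall>k i j. (i, j) \<in> young \<mu> \<longrightarrow> T (i, j) = Plain k \<or> T (i, j) = Barred k \<longrightarrow> i \<le> k)}"

definition tableaux_with_entries_less ::
    "letter \<Rightarrow> (nat \<Rightarrow> nat) \<Rightarrow> (nat \<times> nat \<Rightarrow> letter) set" where
  "tableaux_with_entries_less a \<mu> =
     {T \<in> super_symplectic_tableaux \<mu>. \<forall>b\<in>young \<mu>. T b < a}"

definition delannoy_step :: "int \<times> int \<Rightarrow> int \<times> int \<Rightarrow> bool" where
  "delannoy_step a b \<longleftrightarrow> (fst b - fst a, snd b - snd a) \<in> {(1, 0), (0, 1), (1, 1)}"

text \<open>A path is the list of the lattice points it visits.\<close>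

definition delannoy_paths :: "int \<times> int \<Rightarrow> int \<times> int \<Rightarrow> (int \<times> int) list set" where
  "delannoy_paths a b = {p. p \<noteq> [] \<and> hd p = a \<and> last p = b \<and> successively delannoy_step p}"

definition nonintersecting_delannoy_tuples ::
    "nat \<Rightarrow> (nat \<Rightarrow> nat) \<Rightarrow> (nat \<Rightarrow> (int \<times> int) list) set" where
  "nonintersecting_delannoy_tuples n \<mu> =
     {p \<in> (\<Pi>\<^sub>E i\<in>{1..n}. delannoy_paths (- int i, int i) (int (\<mu> i) - int i, int n)).
        \<forall>i\<in>{1..n}. \<forall>j\<in>{1..n}. i \<noteq> j \<longrightarrow> set (p i) \<inter> set (p j) = {}}"

text \<open>The closed unit square with lower left corner \<open>(a, b)\<close>.\<close>

definition unit_square :: "int \<Rightarrow> int \<Rightarrow> (real \<times> real) set" where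
  "unit_square a b = {real_of_int a..real_of_int a + 1} \<times> {real_of_int b..real_of_int b + 1}"

definition is_domino :: "(real \<times> real) set \<Rightarrow> bool" where
  "is_domino t \<longleftrightarrow>
     (\<exists>a b. t = unit_square a b \<union> unit_square (a + 1) b \<or>
            t = unit_square a b \<union> unit_square a (b + 1))"

definition domino_tilings :: "(real \<times> real) set \<Rightarrow> (real \<times> real) set set set" where
  "domino_tilings D =
     {\<T>. (\<forall>t\<in>\<T>. is_domino t) \<and>
          (\<forall>s\<in>\<T>. \<forall>t\<in>\<T>. s \<noteq> t \<longrightarrow> interior s \<inter> interior t = {}) \<and>
          \<Union>\<T> = D}"

definition aztec_square :: "nat \<Rightarrow> nat \<Rightarrow> (real \<times> real) set" where
  "aztec_square c d = unit_square (int c) (int c - int d)"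

definition aztec_triangle1 :: "nat \<Rightarrow> (nat \<Rightarrow> nat) \<Rightarrow> (real \<times> real) set" where
  "aztec_triangle1 n \<mu> =
     \<Union>{aztec_square c d |c d. d \<le> 2 * n - 2 \<and> int c < int (\<mu> 1) + \<lceil>real d / 2\<rceil>} \<union>
     \<Union>{aztec_square c (2 * n - 1) |c. c \<in> {0..<\<mu> 1 + n} - {\<mu> j + n - j |j. 1 \<le> j \<and> j \<le> n}}"

end

theory Submission
  imports Defs
begin

text \<open>
  Each of the other three sets is a way of drawing a sequence \<open>\<Lambda>\<close> of shapes
  \<open>\<emptyset> = \<Lambda> 0 \<subseteq> \<Lambda> 1 \<subseteq> \<dots> \<subseteq> \<Lambda> (2 n - 1) = \<mu>\<close>, so each of them is put in bijection with the case 1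
  sequences. By \<open>case1_sequences_iff\<close>, such a sequence is an array of numbers in which consecutive
  rows interlace (horizontal strips) or differ by \<open>0\<close> or \<open>1\<close> in every part (vertical strips) and in
  which row \<open>d\<close> has at most \<open>\<lceil>d / 2\<rceil>\<close> nonzero parts.

  Tableaux: write in each box of \<open>\<mu>\<close> the letter that belongs to the step at which the box appears.
  The letters \<open>1 < \<close>bar\<open> 1 < 2 < \<dots>\<close> number the steps, so the strip conditions for steps and for
  letters are the same statement, and the bound on the number of parts says that \<open>k\<close> and bar \<open>k\<close>
  stay in the first \<open>k\<close> rows.

  Paths: a Delannoy path is determined by the abscissas at which it enters and leaves each
  height. Let the \<open>i\<close>-th path enter height \<open>k\<close> at \<open>\<Lambda> (2 k - 2) i - i\<close> and leave it at
  \<open>\<Lambda> (2 k - 1) i - i\<close>. Passing from one height to the next by a north or a northeast step is the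
  vertical strip condition; and at a given height the runs of the paths \<open>i\<close> and \<open>i + 1\<close> are
  disjoint exactly when \<open>\<Lambda> (2 k - 1) (i + 1) \<le> \<Lambda> (2 k - 2) i\<close>, the horizontal strip condition.

  Tilings: a domino joins a square \<open>Q (c, d)\<close> to \<open>Q (c, d + 1)\<close> or to \<open>Q (c + 1, d + 1)\<close>. Let \<open>U d\<close> be
  the set of squares of diagonal \<open>d\<close> whose partner lies on diagonal \<open>d + 1\<close>. Then the tiling matches
  \<open>U d\<close> with the complement of \<open>U (d + 1)\<close> in the next diagonal, by a bijection that moves every
  position by \<open>0\<close> or \<open>1\<close>; such a bijection is unique if it exists (\<open>shift_matching_unique\<close>), so the
  tiling is determined by the sets \<open>U d\<close> (\<open>bij_betw_upward\<close>). Now encode a partition with at most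
  \<open>k\<close> parts by its Maya diagram \<open>{\<nu> j + k - j | 1 \<le> j \<le> k}\<close>, an arbitrary \<open>k\<close>-element set of naturals.
  For odd \<open>d\<close> let \<open>U d\<close> be the Maya diagram of \<open>\<Lambda> d\<close>, for even \<open>d\<close> its complement in the diagonal.
  Moving the elements of a Maya diagram by \<open>0\<close> or \<open>1\<close> adds a vertical strip
  (\<open>vertical_shift_matching_iff\<close>), and moving the elements of the complement by \<open>0\<close> or \<open>1\<close> adds a
  horizontal strip (\<open>horizontal_shift_matching_iff\<close>). The squares missing from the last diagonal
  form the Maya diagram of \<open>\<mu>\<close>, which is the condition \<open>\<Lambda> (2 n - 1) = \<mu>\<close>.

  Finiteness is clear for the tableaux and is carried over by the bijections.
\<close>

section \<open>Case 1 sequences as arrays of inequalities\<close>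

lemma young_subset_iff: "young \<kappa> \<subseteq> young \<nu> \<longleftrightarrow> (\<forall>j\<ge>1. \<kappa> j \<le> \<nu> j)"
proof
  assume sub: "young \<kappa> \<subseteq> young \<nu>"
  show "\<forall>j\<ge>1. \<kappa> j \<le> \<nu> j"
  proof (intro allI impI)
    fix j :: nat assume "1 \<le> j"
    show "\<kappa> j \<le> \<nu> j"
    proof (cases "\<kappa> j = 0")
      case False
      with \<open>1 \<le> j\<close> have "(j, \<kappa> j) \<in> young \<kappa>" by (simp add: young_def)
      with sub show ?thesis by (auto simp: young_def)
    qed simp
  qed
qed (force simp: young_def)

text \<open>If \<open>\<nu> (j + 1) > \<kappa> j\<close>, then rows \<open>j\<close> and \<open>j + 1\<close> both gain a box in column \<open>\<nu> (j + 1)\<close>; two new boxes in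
  one column always force this for adjacent rows, because the parts decrease.\<close>

lemma horizontal_strip_iff:
  assumes "is_partition \<kappa>" "is_partition \<nu>"
  shows "horizontal_strip (young \<nu> - young \<kappa>) \<longleftrightarrow> (\<forall>j\<ge>1. \<nu> (Suc j) \<le> \<kappa> j)"
proof
  assume hs: "horizontal_strip (young \<nu> - young \<kappa>)"
  show "\<forall>j\<ge>1. \<nu> (Suc j) \<le> \<kappa> j"
  proof (intro allI impI, rule ccontr)
    fix j :: nat assume j: "1 \<le> j" and less: "\<not> \<nu> (Suc j) \<le> \<kappa> j"
    have "\<kappa> (Suc j) \<le> \<kappa> j" "\<nu> (Suc j) \<le> \<nu> j"
      using assms j by (simp_all add: is_partition_def)
    with j less have "(j, \<nu> (Suc j)) \<in> young \<nu> - young \<kappa>" "(Suc j, \<nu> (Suc j)) \<in> young \<nu> - young \<kappa>"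
      by (auto simp: young_def)
    with hs have "j = Suc j" unfolding horizontal_strip_def by blast
    then show False by simp
  qed
next
  assume le: "\<forall>j\<ge>1. \<nu> (Suc j) \<le> \<kappa> j"
  have no_pair: False if "(i, c) \<in> young \<nu> - young \<kappa>" "(i', c) \<in> young \<nu> - young \<kappa>" "i < i'" for i i' c
  proof -
    have "c \<le> \<nu> i'" "1 \<le> i" "\<kappa> i < c" using that by (auto simp: young_def)
    moreover have "\<nu> i' \<le> \<nu> (Suc i)"
      using assms(2) that(3) by (auto simp: is_partition_def)
    moreover have "\<nu> (Suc i) \<le> \<kappa> i" using le \<open>1 \<le> i\<close> by blast
    ultimately show False by linarith
  qed
  show "horizontal_strip (young \<nu> - young \<kappa>)"
    unfolding horizontal_strip_def by (metis no_pair linorder_neqE_nat)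
qed

lemma vertical_strip_iff:
  "vertical_strip (young \<nu> - young \<kappa>) \<longleftrightarrow> (\<forall>j\<ge>1. \<nu> j \<le> Suc (\<kappa> j))"
proof
  assume vs: "vertical_strip (young \<nu> - young \<kappa>)"
  show "\<forall>j\<ge>1. \<nu> j \<le> Suc (\<kappa> j)"
  proof (intro allI impI, rule ccontr)
    fix j :: nat assume "1 \<le> j" "\<not> \<nu> j \<le> Suc (\<kappa> j)"
    then have "(j, Suc (\<kappa> j)) \<in> young \<nu> - young \<kappa>" "(j, Suc (Suc (\<kappa> j))) \<in> young \<nu> - young \<kappa>"
      by (auto simp: young_def)
    with vs have "Suc (\<kappa> j) = Suc (Suc (\<kappa> j))" unfolding vertical_strip_def by blast
    then show False by simp
  qed
next
  assume le: "\<forall>j\<ge>1. \<nu> j \<le> Suc (\<kappa> j)"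
  have *: "c = Suc (\<kappa> i)" if "(i, c) \<in> young \<nu> - young \<kappa>" for i c
    using that le by (force simp: young_def)
  show "vertical_strip (young \<nu> - young \<kappa>)"
    unfolding vertical_strip_def by (metis *)
qed

lemma num_parts_le_iff:
  assumes "is_partition \<nu>"
  shows "num_parts \<nu> \<le> m \<longleftrightarrow> (\<forall>j>m. \<nu> j = 0)"
proof
  assume le: "num_parts \<nu> \<le> m"
  show "\<forall>j>m. \<nu> j = 0"
  proof (intro allI impI, rule ccontr)
    fix j assume "j > m" "\<nu> j \<noteq> 0"
    have "{1..j} \<subseteq> {i. \<nu> i \<noteq> 0}"
    proof
      fix i assume "i \<in> {1..j}"
      then have "\<nu> j \<le> \<nu> i" using assms by (auto simp: is_partition_def)
      with \<open>\<nu> j \<noteq> 0\<close> show "i \<in> {i. \<nu> i \<noteq> 0}" by simp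
    qed
    then have "card {1..j} \<le> num_parts \<nu>"
      unfolding num_parts_def using assms by (intro card_mono) (auto simp: is_partition_def)
    with le \<open>j > m\<close> show False by simp
  qed
next
  assume zero: "\<forall>j>m. \<nu> j = 0"
  have "\<nu> 0 = 0" using assms by (simp add: is_partition_def)
  have "{i. \<nu> i \<noteq> 0} \<subseteq> {1..m}"
  proof
    fix i assume "i \<in> {i. \<nu> i \<noteq> 0}"
    then have "\<nu> i \<noteq> 0" by simp
    then have "i \<noteq> 0" "\<not> m < i" using \<open>\<nu> 0 = 0\<close> zero by metis+
    then show "i \<in> {1..m}" by simp
  qed
  then have "num_parts \<nu> \<le> card {1..m}" unfolding num_parts_def by (intro card_mono) auto
  then show "num_parts \<nu> \<le> m" by simp
qed

lemma is_partitionI: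
  assumes "\<nu> 0 = 0" "\<And>j. j > m \<Longrightarrow> \<nu> j = 0" "\<And>j. 1 \<le> j \<Longrightarrow> \<nu> (Suc j) \<le> \<nu> j"
  shows "is_partition \<nu>"
proof -
  have "\<nu> j \<le> \<nu> i" if "1 \<le> i" "i \<le> j" for i j
    using that(2)
  proof (induction j rule: dec_induct)
    case (step k)
    then show ?case using assms(3)[of k] that(1) by linarith
  qed simp
  moreover have "{i. \<nu> i \<noteq> 0} \<subseteq> {..m}" using assms(2) by (auto intro: leI)
  then have "finite {i. \<nu> i \<noteq> 0}" by (rule finite_subset) simp
  ultimately show ?thesis using assms(1) by (auto simp: is_partition_def)
qed

lemma ceiling_half: "\<lceil>real d / 2\<rceil> = int ((d + 1) div 2)"
  by (cases "even d") (auto elim!: evenE oddE simp: ceiling_eq_iff add_divide_distrib)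

text \<open>That every \<open>\<Lambda> d\<close> is a partition is a consequence of the remaining conditions: the horizontal strips
  give \<open>\<Lambda> (2 k) (j + 1) \<le> \<Lambda> (2 k + 1) (j + 1) \<le> \<Lambda> (2 k) j \<le> \<Lambda> (2 k + 1) j\<close>, and every row of the array
  is one of the two rows of such a step. The other three descriptions produce arrays of numbers, for
  which this is the convenient test.\<close>

lemma case1_sequences_iff:
  assumes "n \<ge> 1"
  shows "\<Lambda> \<in> case1_sequences (2 * n) \<mu> \<longleftrightarrow>
    \<Lambda> \<in> extensional {0..<2 * n} \<and> \<Lambda> 0 = (\<lambda>_. 0) \<and> \<Lambda> (2 * n - 1) = \<mu> \<and>
    (\<forall>d<2 * n. \<Lambda> d 0 = 0 \<and> (\<forall>j>(d + 1) div 2. \<Lambda> d j = 0)) \<and>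
    (\<forall>k<n. \<forall>j\<ge>1. \<Lambda> (2 * k) j \<le> \<Lambda> (2 * k + 1) j \<and> \<Lambda> (2 * k + 1) (Suc j) \<le> \<Lambda> (2 * k) j) \<and>
    (\<forall>k. k + 1 < n \<longrightarrow> (\<forall>j\<ge>1. \<Lambda> (2 * k + 1) j \<le> \<Lambda> (2 * k + 2) j \<and>
        \<Lambda> (2 * k + 2) j \<le> Suc (\<Lambda> (2 * k + 1) j)))" (is "_ \<longleftrightarrow> ?R")
proof
  assume L: "\<Lambda> \<in> case1_sequences (2 * n) \<mu>"
  then have part: "is_partition (\<Lambda> d)" if "d < 2 * n" for d
    using that by (auto simp: case1_sequences_def)
  have supp: "\<Lambda> d 0 = 0 \<and> (\<forall>j>(d + 1) div 2. \<Lambda> d j = 0)" if "d < 2 * n" for d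
    using L that num_parts_le_iff[OF part[OF that], of "(d + 1) div 2"] part[OF that]
    by (auto simp: case1_sequences_def ceiling_half is_partition_def)
  have hor: "\<Lambda> (2 * k) j \<le> \<Lambda> (2 * k + 1) j \<and> \<Lambda> (2 * k + 1) (Suc j) \<le> \<Lambda> (2 * k) j"
    if "k < n" "j \<ge> 1" for k j
  proof -
    have "young (\<Lambda> (2 * k)) \<subseteq> young (\<Lambda> (2 * k + 1))"
      "horizontal_strip (young (\<Lambda> (2 * k + 1)) - young (\<Lambda> (2 * k)))"
      using L that by (auto simp: case1_sequences_def)
    then show ?thesis
      using that by (simp add: young_subset_iff horizontal_strip_iff part)
  qed
  have ver: "\<Lambda> (2 * k + 1) j \<le> \<Lambda> (2 * k + 2) j \<and> \<Lambda> (2 * k + 2) j \<le> Suc (\<Lambda> (2 * k + 1) j)"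
    if "k + 1 < n" "j \<ge> 1" for k j
  proof -
    have "\<forall>i. 1 \<le> i \<longrightarrow> 2 * i < 2 * n \<longrightarrow> young (\<Lambda> (2 * i - 1)) \<subseteq> young (\<Lambda> (2 * i)) \<and>
           vertical_strip (young (\<Lambda> (2 * i)) - young (\<Lambda> (2 * i - 1)))"
      using L by (simp add: case1_sequences_def)
    from this[rule_format, of "k + 1"]
    have "young (\<Lambda> (2 * k + 1)) \<subseteq> young (\<Lambda> (2 * k + 2))"
      "vertical_strip (young (\<Lambda> (2 * k + 2)) - young (\<Lambda> (2 * k + 1)))"
      using that by auto
    then show ?thesis using that by (simp add: young_subset_iff vertical_strip_iff)
  qed
  show ?R
    using L supp hor ver by (auto simp: case1_sequences_def PiE_def)
next
  assume R: ?R
  have part: "is_partition (\<Lambda> d)" if d: "d < 2 * n" for d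
  proof (rule is_partitionI[of _ "(d + 1) div 2"])
    fix j :: nat assume j: "1 \<le> j"
    define k where "k = d div 2"
    have k: "k < n" using d by (auto simp: k_def)
    have "\<Lambda> (2 * k) (Suc j) \<le> \<Lambda> (2 * k + 1) (Suc j)" "\<Lambda> (2 * k + 1) (Suc j) \<le> \<Lambda> (2 * k) j"
      "\<Lambda> (2 * k) j \<le> \<Lambda> (2 * k + 1) j"
      using R k j by auto
    moreover have "d = 2 * k \<or> d = 2 * k + 1" by (auto simp: k_def)
    ultimately show "\<Lambda> d (Suc j) \<le> \<Lambda> d j" by auto
  qed (use R d in auto)
  have parts: "num_parts (\<Lambda> d) \<le> (d + 1) div 2" if "d < 2 * n" for d
    using R that by (subst num_parts_le_iff[OF part]) auto
  have hor: "young (\<Lambda> (2 * i)) \<subseteq> young (\<Lambda> (2 * i + 1)) \<and>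
      horizontal_strip (young (\<Lambda> (2 * i + 1)) - young (\<Lambda> (2 * i)))" if "2 * i + 1 < 2 * n" for i
    using R that by (auto simp: young_subset_iff horizontal_strip_iff part)
  have ver: "young (\<Lambda> (2 * i - 1)) \<subseteq> young (\<Lambda> (2 * i)) \<and>
      vertical_strip (young (\<Lambda> (2 * i)) - young (\<Lambda> (2 * i - 1)))" if i: "1 \<le> i" "2 * i < 2 * n" for i
  proof -
    obtain k where "i = Suc k" using i(1) by (cases i) auto
    then show ?thesis using R i by (auto simp: young_subset_iff vertical_strip_iff)
  qed
  show "\<Lambda> \<in> case1_sequences (2 * n) \<mu>"
    unfolding case1_sequences_def mem_Collect_eq PiE_def Pi_def
    using R part parts hor ver by (simp add: ceiling_half)
qed

section \<open>Sequences of shapes and tableaux\<close>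

text \<open>The letter of the step from \<open>\<Lambda> (d - 1)\<close> to \<open>\<Lambda> d\<close>. Letter ranks start at \<open>2\<close> and steps at \<open>1\<close>, whence the
  shift by one below; index \<open>0\<close> gives the junk value \<open>Barred 0\<close>.\<close>

definition letter_at :: "nat \<Rightarrow> letter" where
  "letter_at d = (if odd d then Plain (d div 2 + 1) else Barred (d div 2))"

lemma letter_rank_letter_at [simp]: "letter_rank (letter_at d) = d + 1"
  by (auto simp: letter_at_def elim!: oddE evenE)

lemma letter_at_in_letters: "1 \<le> d \<Longrightarrow> letter_at d \<in> letters"
  by (auto simp: letter_at_def letters_def elim!: oddE evenE)

lemma letter_rank_ge_2: "l \<in> letters \<Longrightarrow> 2 \<le> letter_rank l"
  by (auto simp: letters_def)

lemma young_inject: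
  assumes "young \<kappa> = young \<nu>" "\<kappa> 0 = \<nu> 0"
  shows "\<kappa> = \<nu>"
proof
  fix i
  have "\<forall>j\<ge>1. \<kappa> j = \<nu> j"
    using assms(1) young_subset_iff[of \<kappa> \<nu>] young_subset_iff[of \<nu> \<kappa>] by (auto intro: antisym)
  then show "\<kappa> i = \<nu> i" using assms(2) by (cases i) auto
qed

lemma finite_young:
  assumes "is_partition \<nu>"
  shows "finite (young \<nu>)"
proof (rule finite_subset)
  show "young \<nu> \<subseteq> (SIGMA i:{i. \<nu> i \<noteq> 0}. {..\<nu> i})" by (auto simp: young_def)
  show "finite (SIGMA i:{i. \<nu> i \<noteq> 0}. {..\<nu> i})"
    using assms by (auto simp: is_partition_def)
qed

lemma case1_sequences_mono:
  assumes "\<Lambda> \<in> case1_sequences (2 * n) \<mu>" "d \<le> d'" "d' < 2 * n"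
  shows "young (\<Lambda> d) \<subseteq> young (\<Lambda> d')"
  using assms(2,3)
proof (induction d' rule: dec_induct)
  case (step m)
  have "young (\<Lambda> m) \<subseteq> young (\<Lambda> (Suc m))"
  proof (cases "even m")
    case True
    then show ?thesis using assms(1) step by (auto simp: case1_sequences_def elim!: evenE)
  next
    case False
    then obtain i where i: "m = 2 * i + 1" by (auto elim: oddE)
    have "\<forall>i. 1 \<le> i \<longrightarrow> 2 * i < 2 * n \<longrightarrow> young (\<Lambda> (2 * i - 1)) \<subseteq> young (\<Lambda> (2 * i))"
      using assms(1) by (simp add: case1_sequences_def)
    from this[rule_format, of "i + 1"] show ?thesis using step i by simp
  qed
  with step show ?case by auto
qed simp

definition tableau_of :: "(nat \<Rightarrow> nat) \<Rightarrow> (nat \<Rightarrow> nat \<Rightarrow> nat) \<Rightarrow> nat \<times> nat \<Rightarrow> letter" where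
  "tableau_of \<mu> \<Lambda> = restrict (\<lambda>b. letter_at (LEAST d. b \<in> young (\<Lambda> d))) (young \<mu>)"

text \<open>Rows of a tableau increase, so the boxes of row \<open>i\<close> with entries up to a given rank form an initial
  segment of the row, and counting them gives the \<open>i\<close>-th part of the shape they fill.\<close>

definition shapes_of :: "nat \<Rightarrow> (nat \<Rightarrow> nat) \<Rightarrow> (nat \<times> nat \<Rightarrow> letter) \<Rightarrow> nat \<Rightarrow> nat \<Rightarrow> nat" where
  "shapes_of n \<mu> T = restrict
     (\<lambda>d i. card {j. (i, j) \<in> young \<mu> \<and> letter_rank (T (i, j)) \<le> d + 1}) {0..<2 * n}"

text \<open>Since the shapes grow, the step at which a box appears is at most \<open>d\<close> exactly when the box is in the
  \<open>d\<close>-th shape. Everything about \<^const>\<open>tableau_of\<close> follows from this.\<close>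

lemma tableau_of_rank:
  assumes L: "\<Lambda> \<in> case1_sequences (2 * n) \<mu>" and n: "n \<ge> 1" and b: "b \<in> young \<mu>"
  shows "2 \<le> letter_rank (tableau_of \<mu> \<Lambda> b)" "letter_rank (tableau_of \<mu> \<Lambda> b) \<le> 2 * n"
    and "d < 2 * n \<Longrightarrow> letter_rank (tableau_of \<mu> \<Lambda> b) \<le> d + 1 \<longleftrightarrow> b \<in> young (\<Lambda> d)"
proof -
  define m where "m = (LEAST d. b \<in> young (\<Lambda> d))"
  have rank: "letter_rank (tableau_of \<mu> \<Lambda> b) = m + 1"
    using b by (simp add: tableau_of_def m_def)
  have last: "b \<in> young (\<Lambda> (2 * n - 1))" using L b by (simp add: case1_sequences_def)
  then have bm: "b \<in> young (\<Lambda> m)" unfolding m_def by (rule LeastI)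
  have m_le: "m \<le> d" if "b \<in> young (\<Lambda> d)" for d using that unfolding m_def by (rule Least_le)
  have "\<Lambda> 0 = (\<lambda>_. 0)" using L by (simp add: case1_sequences_def)
  with bm have "m \<noteq> 0" by (cases m) (auto simp: young_def)
  then show "2 \<le> letter_rank (tableau_of \<mu> \<Lambda> b)" using rank by simp
  show "letter_rank (tableau_of \<mu> \<Lambda> b) \<le> 2 * n" using rank m_le[OF last] n by simp
  show "letter_rank (tableau_of \<mu> \<Lambda> b) \<le> d + 1 \<longleftrightarrow> b \<in> young (\<Lambda> d)" if "d < 2 * n"
    using rank m_le bm case1_sequences_mono[OF L _ that, of m] by auto
qed

lemma tableau_of_in_tableaux:
  assumes L: "\<Lambda> \<in> case1_sequences (2 * n) \<mu>" and n: "n \<ge> 1"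
  shows "tableau_of \<mu> \<Lambda> \<in> tableaux_with_entries_less (Barred n) \<mu>"
proof -
  let ?T = "tableau_of \<mu> \<Lambda>"
  note rank = tableau_of_rank[OF L n]
  have entry: "\<exists>d. 1 \<le> d \<and> d < 2 * n \<and> letter_rank (?T b) = d + 1 \<and> b \<in> young (\<Lambda> d) \<and> b \<notin> young (\<Lambda> (d - 1))"
    if b: "b \<in> young \<mu>" for b
  proof -
    \<comment> \<open>The box appears at step \<open>c + 1\<close>: ranks exceed step numbers by one.\<close>
    obtain c where c: "letter_rank (?T b) = Suc (Suc c)"
      using rank(1)[OF b] by (metis add_2_eq_Suc le_Suc_ex)
    then show ?thesis
      using rank(2)[OF b] rank(3)[OF b, of "Suc c"] rank(3)[OF b, of c]
      by (intro exI[of _ "Suc c"]) auto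
  qed
  have part: "is_partition (\<Lambda> d)" if "d < 2 * n" for d
    using L that by (auto simp: case1_sequences_def)
  have le: "?T b \<le> ?T b'" if "b \<in> young \<mu>" "b' \<in> young \<mu>"
    "\<And>d. d < 2 * n \<Longrightarrow> b' \<in> young (\<Lambda> d) \<Longrightarrow> b \<in> young (\<Lambda> d)" for b b'
    using entry[OF that(2)] rank(3)[OF that(1)] that(3) by (auto simp: less_eq_letter_def)
  have rows: "?T (i, j) \<le> ?T (i, j')" if "(i, j) \<in> young \<mu>" "(i, j') \<in> young \<mu>" "j \<le> j'" for i j j'
    using that by (intro le) (auto simp: young_def)
  have columns: "?T (i, j) \<le> ?T (i', j)" if "(i, j) \<in> young \<mu>" "(i', j) \<in> young \<mu>" "i \<le> i'" for i i' j
  proof (rule le)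
    fix d assume "d < 2 * n" "(i', j) \<in> young (\<Lambda> d)"
    moreover have "1 \<le> i" using that(1) by (simp add: young_def)
    ultimately have "\<Lambda> d i' \<le> \<Lambda> d i" using part[of d] \<open>i \<le> i'\<close> by (simp add: is_partition_def)
    then show "(i, j) \<in> young (\<Lambda> d)" using \<open>(i', j) \<in> young (\<Lambda> d)\<close> \<open>1 \<le> i\<close> by (simp add: young_def)
  qed (use that in auto)
  have plain: "horizontal_strip {b \<in> young \<mu>. ?T b = Plain k}" for k
  proof (cases "1 \<le> k \<and> k \<le> n")
    case True
    have "{b \<in> young \<mu>. ?T b = Plain k} \<subseteq> young (\<Lambda> (2 * (k - 1) + 1)) - young (\<Lambda> (2 * (k - 1)))"
    proof
      fix b assume "b \<in> {b \<in> young \<mu>. ?T b = Plain k}"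
      then have b: "b \<in> young \<mu>" "?T b = Plain k" by auto
      obtain d where "1 \<le> d" "letter_rank (?T b) = d + 1" "b \<in> young (\<Lambda> d)" "b \<notin> young (\<Lambda> (d - 1))"
        using entry[OF b(1)] by blast
      moreover have "d = 2 * (k - 1) + 1" "d - 1 = 2 * (k - 1)"
        using calculation(1,2) b(2) by auto
      ultimately show "b \<in> young (\<Lambda> (2 * (k - 1) + 1)) - young (\<Lambda> (2 * (k - 1)))" by auto
    qed
    moreover have "horizontal_strip (young (\<Lambda> (2 * (k - 1) + 1)) - young (\<Lambda> (2 * (k - 1))))"
      using L True by (auto simp: case1_sequences_def)
    ultimately show ?thesis unfolding horizontal_strip_def by blast
  next
    case False
    then have none: "{b \<in> young \<mu>. ?T b = Plain k} = {}" using rank(1,2) by force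
    show ?thesis unfolding none by (simp add: horizontal_strip_def)
  qed
  have barred: "vertical_strip {b \<in> young \<mu>. ?T b = Barred k}" for k
  proof (cases "1 \<le> k \<and> k < n")
    case True
    have "{b \<in> young \<mu>. ?T b = Barred k} \<subseteq> young (\<Lambda> (2 * k)) - young (\<Lambda> (2 * k - 1))"
    proof -
      have "b \<in> young (\<Lambda> (2 * k)) - young (\<Lambda> (2 * k - 1))" if "b \<in> young \<mu>" "?T b = Barred k" for b
        using entry[OF that(1)] that(2) by auto
      then show ?thesis by blast
    qed
    moreover have "vertical_strip (young (\<Lambda> (2 * k)) - young (\<Lambda> (2 * k - 1)))"
      using L True by (auto simp: case1_sequences_def)
    ultimately show ?thesis unfolding vertical_strip_def by blast
  next
    case False
    then have none: "{b \<in> young \<mu>. ?T b = Barred k} = {}" using rank(1,2) by force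
    show ?thesis unfolding none by (simp add: vertical_strip_def)
  qed
  have row_bound: "i \<le> k"
    if ij: "(i, j) \<in> young \<mu>" and k: "?T (i, j) = Plain k \<or> ?T (i, j) = Barred k" for k i j
  proof -
    obtain d where d: "d < 2 * n" "letter_rank (?T (i, j)) = d + 1" "(i, j) \<in> young (\<Lambda> d)"
      using entry[OF ij] by auto
    have "d + 1 = 2 * k \<or> d + 1 = 2 * k + 1" using k d(2) by auto
    then have "k = (d + 1) div 2" by auto
    moreover have "\<Lambda> d i \<noteq> 0" using d(3) by (auto simp: young_def)
    ultimately show ?thesis
      using L d(1) case1_sequences_iff[OF n] by (metis leI)
  qed
  have "?T \<in> young \<mu> \<rightarrow>\<^sub>E letters"
    using rank(1) by (auto simp: tableau_of_def intro!: letter_at_in_letters)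
  moreover have "?T b < Barred n" if "b \<in> young \<mu>" for b
    using rank(2)[OF that] by (simp add: less_letter_def)
  ultimately show ?thesis
    unfolding tableaux_with_entries_less_def super_symplectic_tableaux_def mem_Collect_eq
    by (intro conjI allI impI ballI) 
      (assumption | (rule rows columns plain barred row_bound; assumption) | blast)+
qed

lemma initial_segment_of_down_closed:
  assumes "finite J" "\<And>j. j \<in> J \<Longrightarrow> 1 \<le> j" "\<And>j j'. j' \<in> J \<Longrightarrow> 1 \<le> j \<Longrightarrow> j \<le> j' \<Longrightarrow> j \<in> J"
  shows "J = {1..card J}"
proof (cases "J = {}")
  case False
  have "J = {1..Max J}"
  proof
    show "J \<subseteq> {1..Max J}" using assms(1,2) by auto
    show "{1..Max J} \<subseteq> J" using assms(3)[OF Max_in[OF assms(1) False]] by auto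
  qed
  then have "card J = Max J" by (metis card_atLeastAtMost diff_Suc_1)
  with \<open>J = {1..Max J}\<close> show ?thesis by simp
qed simp

lemma young_shapes_of:
  assumes T: "T \<in> tableaux_with_entries_less a \<mu>" and d: "d < 2 * n"
  shows "young (shapes_of n \<mu> T d) = {b \<in> young \<mu>. letter_rank (T b) \<le> d + 1}"
proof -
  have "j \<le> shapes_of n \<mu> T d i \<longleftrightarrow> (i, j) \<in> young \<mu> \<and> letter_rank (T (i, j)) \<le> d + 1"
    if ij: "1 \<le> i" "1 \<le> j" for i j
  proof -
    let ?J = "{j. (i, j) \<in> young \<mu> \<and> letter_rank (T (i, j)) \<le> d + 1}"
    have "?J = {1..card ?J}"
    proof (rule initial_segment_of_down_closed)
      show "finite ?J" by (rule finite_subset[of _ "{..\<mu> i}"]) (auto simp: young_def)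
    next
      fix j j' assume j: "j' \<in> ?J" "1 \<le> j" "j \<le> j'"
      then have "(i, j) \<in> young \<mu>" by (auto simp: young_def)
      moreover have "T (i, j) \<le> T (i, j')"
        using T j calculation by (auto simp: tableaux_with_entries_less_def super_symplectic_tableaux_def)
      ultimately show "j \<in> ?J" using j by (auto simp: less_eq_letter_def)
    qed (auto simp: young_def)
    then have "j \<in> ?J \<longleftrightarrow> j \<in> {1..card ?J}" by (rule arg_cong)
    then show ?thesis using ij d by (simp add: shapes_of_def)
  qed
  then show ?thesis by (auto simp: young_def)
qed

lemma shapes_of_in_case1_sequences:
  assumes T: "T \<in> tableaux_with_entries_less (Barred n) \<mu>" and n: "n \<ge> 1" and \<mu>: "is_partition \<mu>"
  shows "shapes_of n \<mu> T \<in> case1_sequences (2 * n) \<mu>"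
proof -
  let ?S = "shapes_of n \<mu> T"
  note young = young_shapes_of[OF T, of _ n]
  have T': "T \<in> young \<mu> \<rightarrow>\<^sub>E letters"
    "\<And>i i' j. (i, j) \<in> young \<mu> \<Longrightarrow> (i', j) \<in> young \<mu> \<Longrightarrow> i \<le> i' \<Longrightarrow> T (i, j) \<le> T (i', j)"
    "\<And>k. horizontal_strip {b \<in> young \<mu>. T b = Plain k}"
    "\<And>k. vertical_strip {b \<in> young \<mu>. T b = Barred k}"
    "\<And>k i j. (i, j) \<in> young \<mu> \<Longrightarrow> T (i, j) = Plain k \<or> T (i, j) = Barred k \<Longrightarrow> i \<le> k"
    "\<And>b. b \<in> young \<mu> \<Longrightarrow> T b < Barred n"
    using T by (auto simp: tableaux_with_entries_less_def super_symplectic_tableaux_def)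
  have zero: "?S d 0 = 0" if "d < 2 * n" for d
    using that by (simp add: shapes_of_def young_def)
  have row_bound: "i \<le> (d + 1) div 2" if "d < 2 * n" "?S d i \<noteq> 0" for d i
  proof -
    have "1 \<le> i" using zero[OF that(1)] that(2) by (cases i) auto
    then have "(i, 1) \<in> young (?S d)" using that(2) by (simp add: young_def)
    then have b: "(i, 1) \<in> young \<mu>" "letter_rank (T (i, 1)) \<le> d + 1" using young[OF that(1)] by auto
    have "i \<le> letter_rank (T (i, 1)) div 2"
      using T'(5)[OF b(1)] by (cases "T (i, 1)") auto
    also have "\<dots> \<le> (d + 1) div 2" using b(2) by (rule div_le_mono)
    finally show ?thesis .
  qed
  have part: "is_partition (?S d)" if d: "d < 2 * n" for d
  proof (rule is_partitionI[of _ "(d + 1) div 2"])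
    fix i :: nat assume i: "1 \<le> i"
    show "?S d (Suc i) \<le> ?S d i"
    proof (cases "?S d (Suc i) = 0")
      case False
      let ?c = "?S d (Suc i)"
      have b: "(Suc i, ?c) \<in> young (?S d)" using False by (simp add: young_def)
      have "\<mu> (Suc i) \<le> \<mu> i" using \<mu> i by (simp add: is_partition_def)
      with b have "(i, ?c) \<in> young \<mu>" unfolding young[OF d] using i by (auto simp: young_def)
      moreover have "T (i, ?c) \<le> T (Suc i, ?c)"
        using b calculation unfolding young[OF d] by (auto intro: T'(2))
      ultimately have "(i, ?c) \<in> young (?S d)"
        using b unfolding young[OF d] by (auto simp: less_eq_letter_def)
      then show ?thesis by (simp add: young_def)
    qed simp
  next
    show "?S d j = 0" if "(d + 1) div 2 < j" for j
      using row_bound[OF d, of j] that by (meson leD)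
  qed (rule zero[OF d])
  have rank_eq: "young (?S (Suc d)) - young (?S d) = {b \<in> young \<mu>. T b = letter_at (Suc d)}"
    if "Suc d < 2 * n" for d
    using young[of d] young[of "Suc d"] that
    by (auto simp: letter_rank_inject[symmetric])
  have mono: "young (?S d) \<subseteq> young (?S (Suc d))" if "Suc d < 2 * n" for d
    using young[of d] young[of "Suc d"] that by auto
  have hor: "young (?S (2 * i)) \<subseteq> young (?S (2 * i + 1)) \<and>
      horizontal_strip (young (?S (2 * i + 1)) - young (?S (2 * i)))" if "2 * i + 1 < 2 * n" for i
    using rank_eq[of "2 * i"] mono[of "2 * i"] T'(3)[of "i + 1"] that by (simp add: letter_at_def)
  have ver: "young (?S (2 * i - 1)) \<subseteq> young (?S (2 * i)) \<and>
      vertical_strip (young (?S (2 * i)) - young (?S (2 * i - 1)))" if "1 \<le> i" "2 * i < 2 * n" for i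
    using rank_eq[of "2 * i - 1"] mono[of "2 * i - 1"] T'(4)[of i] that by (simp add: letter_at_def)
  have first: "?S 0 = (\<lambda>_. 0)"
  proof (rule young_inject)
    have "\<not> letter_rank (T b) \<le> 0 + 1" if "b \<in> young \<mu>" for b
      using letter_rank_ge_2[OF PiE_mem[OF T'(1) that]] by simp
    then show "young (?S 0) = young (\<lambda>_. 0)" using young[of 0] n by (auto simp: young_def)
  qed (use zero n in auto)
  have last: "?S (2 * n - 1) = \<mu>"
  proof (rule young_inject)
    show "young (?S (2 * n - 1)) = young \<mu>" using young[of "2 * n - 1"] n T'(6) by (auto simp: less_letter_def less_Suc_eq_le)
  qed (use zero n \<mu> in \<open>auto simp: is_partition_def\<close>)
  have "num_parts (?S d) \<le> (d + 1) div 2" if "d < 2 * n" for d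
    unfolding num_parts_le_iff[OF part[OF that]] using row_bound[OF that] by (meson leD)
  moreover have "?S \<in> extensional {0..<2 * n}" by (simp add: shapes_of_def)
  ultimately show ?thesis
    unfolding case1_sequences_def mem_Collect_eq PiE_def Pi_def
    using hor ver first last part by (simp add: ceiling_half)
qed

text \<open>Both round trips compare sets of boxes: the boxes whose entry has rank at most \<open>d + 1\<close> are the boxes
  of the \<open>d\<close>-th shape.\<close>

lemma bij_betw_tableau_of:
  assumes n: "n \<ge> 1" and \<mu>: "is_partition \<mu>"
  shows "bij_betw (tableau_of \<mu>) (case1_sequences (2 * n) \<mu>) (tableaux_with_entries_less (Barred n) \<mu>)"
proof (rule bij_betw_byWitness[where f' = "shapes_of n \<mu>"])
  show "\<forall>\<Lambda>\<in>case1_sequences (2 * n) \<mu>. shapes_of n \<mu> (tableau_of \<mu> \<Lambda>) = \<Lambda>"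
  proof (intro ballI, rule ext)
    fix \<Lambda> d assume L: "\<Lambda> \<in> case1_sequences (2 * n) \<mu>"
    show "shapes_of n \<mu> (tableau_of \<mu> \<Lambda>) d = \<Lambda> d"
    proof (cases "d < 2 * n")
      case True
      have T: "tableau_of \<mu> \<Lambda> \<in> tableaux_with_entries_less (Barred n) \<mu>"
        using L n by (rule tableau_of_in_tableaux)
      show ?thesis
      proof (rule young_inject)
        have "young (\<Lambda> d) \<subseteq> young \<mu>"
          using case1_sequences_mono[OF L, of d "2 * n - 1"] True n L by (simp add: case1_sequences_def)
        then show "young (shapes_of n \<mu> (tableau_of \<mu> \<Lambda>) d) = young (\<Lambda> d)"
          unfolding young_shapes_of[OF T True] using tableau_of_rank(3)[OF L n _ True] by auto
        show "shapes_of n \<mu> (tableau_of \<mu> \<Lambda>) d 0 = \<Lambda> d 0"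
          using shapes_of_in_case1_sequences[OF T n \<mu>] L True case1_sequences_iff[OF n] by metis
      qed
    next
      case False
      then show ?thesis using L by (auto simp: shapes_of_def case1_sequences_def PiE_def extensional_def)
    qed
  qed
  show "\<forall>T\<in>tableaux_with_entries_less (Barred n) \<mu>. tableau_of \<mu> (shapes_of n \<mu> T) = T"
  proof (intro ballI ext)
    fix T b assume T: "T \<in> tableaux_with_entries_less (Barred n) \<mu>"
    show "tableau_of \<mu> (shapes_of n \<mu> T) b = T b"
    proof (cases "b \<in> young \<mu>")
      case True
      have L: "shapes_of n \<mu> T \<in> case1_sequences (2 * n) \<mu>"
        using T n \<mu> by (rule shapes_of_in_case1_sequences)
      have "letter_rank (tableau_of \<mu> (shapes_of n \<mu> T) b) \<le> d + 1 \<longleftrightarrow> letter_rank (T b) \<le> d + 1"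
        if "d < 2 * n" for d
        unfolding tableau_of_rank(3)[OF L n True that] young_shapes_of[OF T that] using True by simp
      note iff = this[of "letter_rank (T b) - 1"] this[of "letter_rank (tableau_of \<mu> (shapes_of n \<mu> T) b) - 1"]
      have "2 \<le> letter_rank (T b)"
        using T True by (intro letter_rank_ge_2) (auto simp: tableaux_with_entries_less_def super_symplectic_tableaux_def)
      moreover have "letter_rank (T b) \<le> 2 * n"
        using T True by (auto simp: tableaux_with_entries_less_def less_letter_def)
      ultimately have "letter_rank (tableau_of \<mu> (shapes_of n \<mu> T) b) = letter_rank (T b)"
        using iff tableau_of_rank(1,2)[OF L n True] by linarith
      then show ?thesis by (simp add: letter_rank_inject)
    next
      case False
      have "T \<in> young \<mu> \<rightarrow>\<^sub>E letters"
        using T by (simp add: tableaux_with_entries_less_def super_symplectic_tableaux_def)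
      then have "T b = undefined" using False by (rule PiE_arb)
      then show ?thesis using False by (simp add: tableau_of_def)
    qed
  qed
  show "tableau_of \<mu> ` case1_sequences (2 * n) \<mu> \<subseteq> tableaux_with_entries_less (Barred n) \<mu>"
    using tableau_of_in_tableaux[OF _ n] by (rule image_subsetI)
  show "shapes_of n \<mu> ` tableaux_with_entries_less (Barred n) \<mu> \<subseteq> case1_sequences (2 * n) \<mu>"
    using shapes_of_in_case1_sequences[OF _ n \<mu>] by (rule image_subsetI)
qed

lemma finite_tableaux_with_entries_less:
  assumes "is_partition \<mu>"
  shows "finite (tableaux_with_entries_less a \<mu>)"
proof (rule finite_subset)
  show "tableaux_with_entries_less a \<mu> \<subseteq> young \<mu> \<rightarrow>\<^sub>E {l. letter_rank l < letter_rank a}"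
    by (auto simp: tableaux_with_entries_less_def super_symplectic_tableaux_def less_letter_def PiE_def)
  have "finite {l. letter_rank l < letter_rank a}"
    by (rule finite_imageD[where f = letter_rank], rule finite_subset[of _ "{..<letter_rank a}"])
      (auto simp: inj_on_def letter_rank_inject)
  then show "finite (young \<mu> \<rightarrow>\<^sub>E {l. letter_rank l < letter_rank a})"
    using finite_young[OF assms] by (rule finite_PiE[rotated])
qed

section \<open>Sequences of shapes and non-intersecting paths\<close>

text \<open>The path that at each height \<open>k\<close> from \<open>h\<close> to \<open>n\<close> runs east from abscissa \<open>a k\<close> to abscissa \<open>e k\<close>.\<close>

definition level_path :: "(nat \<Rightarrow> int) \<Rightarrow> (nat \<Rightarrow> int) \<Rightarrow> nat \<Rightarrow> nat \<Rightarrow> (int \<times> int) list" where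
  "level_path a e h n = concat (map (\<lambda>k. map (\<lambda>x. (x, int k)) [a k..e k]) [h..<Suc n])"

text \<open>The conditions under which \<open>level_path a e h n\<close> makes Delannoy steps; between two heights the step is
  north or northeast.\<close>

definition level_steps :: "(nat \<Rightarrow> int) \<Rightarrow> (nat \<Rightarrow> int) \<Rightarrow> nat \<Rightarrow> nat \<Rightarrow> bool" where
  "level_steps a e h n \<longleftrightarrow>
     (\<forall>k. h \<le> k \<longrightarrow> k \<le> n \<longrightarrow> a k \<le> e k) \<and>
     (\<forall>k. h \<le> k \<longrightarrow> k < n \<longrightarrow> a (Suc k) = e k \<or> a (Suc k) = e k + 1)"

lemma set_level_path:
  "set (level_path a e h n) = {(x, int k) |x k. h \<le> k \<and> k \<le> n \<and> a k \<le> x \<and> x \<le> e k}"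
  by (fastforce simp: level_path_def simp del: upt_Suc)

lemma level_path_peel:
  "h \<le> n \<Longrightarrow> level_path a e h n = map (\<lambda>x. (x, int h)) [a h..e h] @ level_path a e (Suc h) n"
  by (simp add: level_path_def upt_conv_Cons del: upt_Suc)

lemma level_path_cong:
  assumes "\<And>k. h \<le> k \<Longrightarrow> k \<le> n \<Longrightarrow> a k = a' k" "\<And>k. h \<le> k \<Longrightarrow> k \<le> n \<Longrightarrow> e k = e' k"
  shows "level_path a e h n = level_path a' e' h n"
  unfolding level_path_def using assms by (intro arg_cong[where f = concat] map_cong) auto

lemma level_path_empty: "n < h \<Longrightarrow> level_path a e h n = []"
  by (simp add: level_path_def)

lemma hd_upto: "i \<le> j \<Longrightarrow> hd [i..j] = i"
  by (simp add: upto_rec1)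

lemma last_upto: "i \<le> j \<Longrightarrow> last [i..j] = j"
  by (simp add: upto_rec2)

lemma delannoy_run:
  assumes "i \<le> j"
  shows "map (\<lambda>x. (x, y)) [i..j] \<in> delannoy_paths (i, y) (j, y)"
proof -
  have "successively delannoy_step (map (\<lambda>x. (x, y)) [i..j])"
  proof (induction i j rule: upto.induct)
    case (1 i j)
    show ?case
    proof (cases "i < j")
      case True
      then have "[i..j] = i # (i + 1) # [i + 2..j]"
        by (simp add: upto_rec1 add.assoc)
      moreover have "[i + 1..j] = (i + 1) # [i + 2..j]"
        using True by (simp add: upto_rec1 add.assoc)
      ultimately show ?thesis using 1 True by (simp add: delannoy_step_def)
    qed (cases "i = j"; simp)
  qed
  then show ?thesis
    using assms by (simp add: delannoy_paths_def hd_map last_map hd_upto last_upto)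
qed

lemma delannoy_append:
  assumes "p \<in> delannoy_paths a b" "q \<in> delannoy_paths b' c" "delannoy_step b b'"
  shows "p @ q \<in> delannoy_paths a c"
  using assms by (auto simp: delannoy_paths_def successively_append_iff)

lemma level_path_in_delannoy_paths:
  assumes "h \<le> n" "level_steps a e h n"
  shows "level_path a e h n \<in> delannoy_paths (a h, int h) (e n, int n)"
  using assms
proof (induction h rule: inc_induct)
  case base
  then show ?case
    by (simp add: level_path_peel level_path_empty level_steps_def delannoy_run)
next
  case (step h)
  have "level_steps a e (Suc h) n" using step.prems by (simp add: level_steps_def)
  moreover have "delannoy_step (e h, int h) (a (Suc h), int (Suc h))"
    using step by (auto simp: level_steps_def delannoy_step_def)
  moreover have "a h \<le> e h" using step by (simp add: level_steps_def)
  ultimately show ?case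
    using step by (auto simp: level_path_peel[of h] intro: delannoy_append[OF delannoy_run])
qed

text \<open>The induction removes the first point. An east step extends the run at height \<open>h\<close> to the left; any
  other step makes the first point a run of length zero.\<close>

lemma delannoy_path_eq_level_path:
  assumes "p \<in> delannoy_paths (\<alpha>, int h) (\<beta>, int n)"
  shows "h \<le> n \<and> (\<exists>a e. level_steps a e h n \<and> a h = \<alpha> \<and> e n = \<beta> \<and> p = level_path a e h n)"
  using assms
proof (induction p arbitrary: \<alpha> h)
  case Nil
  then show ?case by (simp add: delannoy_paths_def)
next
  case (Cons v q)
  have v: "v = (\<alpha>, int h)" using Cons.prems by (simp add: delannoy_paths_def)
  show ?case
  proof (cases q)
    case Nil
    then have "\<alpha> = \<beta>" "h = n" using Cons.prems v by (auto simp: delannoy_paths_def)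
    then have "level_steps (\<lambda>_. \<alpha>) (\<lambda>_. \<alpha>) h n \<and> v # q = level_path (\<lambda>_. \<alpha>) (\<lambda>_. \<alpha>) h n"
      using Nil v by (simp add: level_steps_def level_path_peel level_path_empty)
    then show ?thesis using \<open>\<alpha> = \<beta>\<close> \<open>h = n\<close> by blast
  next
    case (Cons w q')
    have q: "q \<in> delannoy_paths w (\<beta>, int n)" and "delannoy_step v w"
      using Cons.prems Cons by (auto simp: delannoy_paths_def)
    then consider (east) "w = (\<alpha> + 1, int h)" | (up) \<alpha>' where "w = (\<alpha>', int (Suc h))" "\<alpha>' = \<alpha> \<or> \<alpha>' = \<alpha> + 1"
      using v by (cases w) (auto simp: delannoy_step_def)
    then show ?thesis
    proof cases
      case east
      then obtain a e where ae: "h \<le> n" "level_steps a e h n" "a h = \<alpha> + 1" "e n = \<beta>" "q = level_path a e h n"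
        using Cons.IH q by blast
      let ?a = "a(h := \<alpha>)"
      have "\<alpha> + 1 \<le> e h" using ae by (auto simp: level_steps_def)
      then have "level_steps ?a e h n" using ae by (auto simp: level_steps_def)
      moreover have "level_path ?a e (Suc h) n = level_path a e (Suc h) n"
        by (rule level_path_cong) auto
      then have "v # q = level_path ?a e h n"
        using ae \<open>\<alpha> + 1 \<le> e h\<close> v by (simp add: level_path_peel[of h] upto_rec1[of \<alpha>])
      moreover have "?a h = \<alpha>" by simp
      ultimately show ?thesis using ae(1,4) by blast
    next
      case up
      then obtain a e where ae: "Suc h \<le> n" "level_steps a e (Suc h) n" "a (Suc h) = \<alpha>'" "e n = \<beta>"
          "q = level_path a e (Suc h) n"
        using Cons.IH q by blast
      let ?a = "a(h := \<alpha>)" and ?e = "e(h := \<alpha>)"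
      have "level_steps ?a ?e h n" using ae up by (auto simp: level_steps_def Suc_le_eq nat_less_le)
      moreover have "level_path ?a ?e (Suc h) n = level_path a e (Suc h) n"
        by (rule level_path_cong) auto
      then have "v # q = level_path ?a ?e h n"
        using ae v by (simp add: level_path_peel[of h])
      moreover have "?a h = \<alpha>" "?e n = \<beta>" "h \<le> n" using ae by auto
      ultimately show ?thesis by blast
    qed
  qed
qed

text \<open>The set of points at height \<open>k\<close> is a nonempty interval, which determines its end points.\<close>

lemma level_path_inject:
  assumes "level_path a e h n = level_path a' e' h n" "level_steps a e h n" "level_steps a' e' h n"
    "h \<le> k" "k \<le> n"
  shows "a k = a' k" "e k = e' k"
proof -
  have level: "{x. (x, int k) \<in> set (level_path b f h n)} = {b k..f k}" for b f
    using assms(4,5) by (auto simp: set_level_path)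
  have "{a k..e k} = {a' k..e' k}" unfolding level[symmetric] assms(1) ..
  moreover have "a k \<le> e k" using assms(2,4,5) by (simp add: level_steps_def)
  ultimately show "a k = a' k" "e k = e' k" by (simp_all add: Icc_eq_Icc)
qed

lemma level_steps_ge:
  assumes "level_steps a e h n" "h \<le> k" "k \<le> n"
  shows "a h \<le> a k"
  using assms(2,3)
proof (induction k rule: dec_induct)
  case (step k)
  then have "a k \<le> e k" "e k \<le> a (Suc k)" using assms(1) by (force simp: level_steps_def)+
  with step show ?case by simp
qed simp

lemma disjoint_level_paths_iff:
  "set (level_path a e h n) \<inter> set (level_path a' e' h' n) = {} \<longleftrightarrow>
     (\<forall>k. h \<le> k \<longrightarrow> h' \<le> k \<longrightarrow> k \<le> n \<longrightarrow> {a k..e k} \<inter> {a' k..e' k} = {})"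
  by (fastforce simp: set_level_path)

text \<open>A path that enters the first common height to the left of another one stays to its left: from one
  height to the next it gains at most one on the other path, so before it could overtake, the two
  would share a point.\<close>

lemma level_paths_ordered:
  assumes ae: "level_steps a e h n" and ae': "level_steps a' e' h' n" and "h \<le> h'"
    and disj: "set (level_path a e h n) \<inter> set (level_path a' e' h' n) = {}"
    and start: "a' h' < a h'" and k: "h' \<le> k" "k \<le> n"
  shows "e' k < a k"
proof -
  have dj: "{a k..e k} \<inter> {a' k..e' k} = {}" if "h' \<le> k" "k \<le> n" for k
    using disj that \<open>h \<le> h'\<close> by (simp add: disjoint_level_paths_iff)
  have ord: "e' k < a k" if "a' k < a k" "h' \<le> k" "k \<le> n" for k
  proof (rule ccontr)
    assume "\<not> e' k < a k"
    moreover have "a k \<le> e k" using ae that \<open>h \<le> h'\<close> by (simp add: level_steps_def)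
    ultimately have "a k \<in> {a k..e k} \<inter> {a' k..e' k}" using that by simp
    with dj that show False by blast
  qed
  show ?thesis
    using k
  proof (induction k rule: dec_induct)
    case base
    then show ?case using ord start by simp
  next
    case (step k)
    have "a k \<le> e k" "a (Suc k) = e k \<or> a (Suc k) = e k + 1" "a (Suc k) \<le> e (Suc k)"
      "a' (Suc k) = e' k \<or> a' (Suc k) = e' k + 1" "a' (Suc k) \<le> e' (Suc k)"
      using ae ae' step \<open>h \<le> h'\<close> by (simp_all add: level_steps_def)
    moreover have "e' k < a k" using step by simp
    moreover have "a (Suc k) \<noteq> a' (Suc k)"
    proof
      assume "a (Suc k) = a' (Suc k)"
      then have "a (Suc k) \<in> {a (Suc k)..e (Suc k)} \<inter> {a' (Suc k)..e' (Suc k)}"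
        using calculation by simp
      with dj[of "Suc k"] step show False by simp
    qed
    ultimately have "a' (Suc k) < a (Suc k)" by linarith
    then show ?case using ord step by simp
  qed
qed

text \<open>Height \<open>k\<close> corresponds to the horizontal strip from \<open>\<Lambda> (2 k - 2)\<close> to \<open>\<Lambda> (2 k - 1)\<close>. Subtracting \<open>i\<close>
  turns the weak inequalities between parts into strict inequalities between abscissas.\<close>

definition entry_point :: "(nat \<Rightarrow> nat \<Rightarrow> nat) \<Rightarrow> nat \<Rightarrow> nat \<Rightarrow> int" where
  "entry_point \<Lambda> i k = int (\<Lambda> (2 * k - 2) i) - int i"

definition exit_point :: "(nat \<Rightarrow> nat \<Rightarrow> nat) \<Rightarrow> nat \<Rightarrow> nat \<Rightarrow> int" where
  "exit_point \<Lambda> i k = int (\<Lambda> (2 * k - 1) i) - int i"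

definition paths_of :: "nat \<Rightarrow> (nat \<Rightarrow> nat \<Rightarrow> nat) \<Rightarrow> nat \<Rightarrow> (int \<times> int) list" where
  "paths_of n \<Lambda> = restrict (\<lambda>i. level_path (entry_point \<Lambda> i) (exit_point \<Lambda> i) i n) {1..n}"

context
  fixes n :: nat and \<mu> :: "nat \<Rightarrow> nat" and \<Lambda> :: "nat \<Rightarrow> nat \<Rightarrow> nat"
  assumes n: "n \<ge> 1" and L: "\<Lambda> \<in> case1_sequences (2 * n) \<mu>"
begin

lemma case1_horizontal:
  assumes "1 \<le> k" "k \<le> n" "1 \<le> i"
  shows "\<Lambda> (2 * k - 2) i \<le> \<Lambda> (2 * k - 1) i" "\<Lambda> (2 * k - 1) (Suc i) \<le> \<Lambda> (2 * k - 2) i"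
proof -
  obtain l where "k = Suc l" using assms by (cases k) auto
  then show "\<Lambda> (2 * k - 2) i \<le> \<Lambda> (2 * k - 1) i" "\<Lambda> (2 * k - 1) (Suc i) \<le> \<Lambda> (2 * k - 2) i"
    using L[unfolded case1_sequences_iff[OF n]] assms by auto
qed

lemma case1_vertical:
  assumes "1 \<le> k" "k < n" "1 \<le> i"
  shows "\<Lambda> (2 * k) i = \<Lambda> (2 * k - 1) i \<or> \<Lambda> (2 * k) i = Suc (\<Lambda> (2 * k - 1) i)"
proof -
  obtain l where "k = Suc l" using assms by (cases k) auto
  then have "\<Lambda> (2 * k - 1) i \<le> \<Lambda> (2 * k) i \<and> \<Lambda> (2 * k) i \<le> Suc (\<Lambda> (2 * k - 1) i)"
    using L[unfolded case1_sequences_iff[OF n]] assms by auto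
  then show ?thesis by auto
qed

lemma level_steps_case1:
  assumes "1 \<le> i" "i \<le> n"
  shows "level_steps (entry_point \<Lambda> i) (exit_point \<Lambda> i) i n"
proof -
  have "entry_point \<Lambda> i k \<le> exit_point \<Lambda> i k" if "i \<le> k" "k \<le> n" for k
    using case1_horizontal(1)[of k i] assms that by (simp add: entry_point_def exit_point_def)
  moreover have "entry_point \<Lambda> i (Suc k) = exit_point \<Lambda> i k \<or> entry_point \<Lambda> i (Suc k) = exit_point \<Lambda> i k + 1"
    if "i \<le> k" "k < n" for k
    using case1_vertical[of k i] assms that by (auto simp: entry_point_def exit_point_def)
  ultimately show ?thesis by (auto simp: level_steps_def)
qed

lemma paths_of_disjoint:
  assumes "1 \<le> i" "i < j" "j \<le> n"
  shows "set (paths_of n \<Lambda> i) \<inter> set (paths_of n \<Lambda> j) = {}"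
proof -
  have "exit_point \<Lambda> j k < entry_point \<Lambda> i k" if k: "j \<le> k" "k \<le> n" for k
  proof -
    have "is_partition (\<Lambda> (2 * k - 1))"
      using L k assms by (auto simp: case1_sequences_def)
    then have "\<Lambda> (2 * k - 1) j \<le> \<Lambda> (2 * k - 1) (Suc i)"
      using assms by (auto simp: is_partition_def)
    also have "\<dots> \<le> \<Lambda> (2 * k - 2) i" using case1_horizontal(2)[of k i] assms k by simp
    finally show ?thesis using assms by (simp add: entry_point_def exit_point_def)
  qed
  then have "set (level_path (entry_point \<Lambda> i) (exit_point \<Lambda> i) i n)
      \<inter> set (level_path (entry_point \<Lambda> j) (exit_point \<Lambda> j) j n) = {}"
    unfolding disjoint_level_paths_iff by force
  then show ?thesis using assms by (simp add: paths_of_def)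
qed

text \<open>The \<open>i\<close>-th path starts at height \<open>i\<close>, where \<open>\<Lambda> (2 i - 2)\<close> has at most \<open>i - 1\<close> parts; hence its first
  abscissa is \<open>- i\<close>.\<close>

lemma paths_of_in_tuples: "paths_of n \<Lambda> \<in> nonintersecting_delannoy_tuples n \<mu>"
proof -
  have "paths_of n \<Lambda> i \<in> delannoy_paths (- int i, int i) (int (\<mu> i) - int i, int n)"
    if "i \<in> {1..n}" for i
  proof -
    have "\<Lambda> (2 * i - 2) i = 0"
      using L[unfolded case1_sequences_iff[OF n]] that by auto
    then have "entry_point \<Lambda> i i = - int i" by (simp add: entry_point_def)
    moreover have "exit_point \<Lambda> i n = int (\<mu> i) - int i"
      using L by (simp add: exit_point_def case1_sequences_def)
    ultimately show ?thesis
      using level_path_in_delannoy_paths[OF _ level_steps_case1, of i] that by (simp add: paths_of_def)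
  qed
  moreover have "set (paths_of n \<Lambda> i) \<inter> set (paths_of n \<Lambda> j) = {}"
    if "i \<in> {1..n}" "j \<in> {1..n}" "i \<noteq> j" for i j
    using paths_of_disjoint[of i j] paths_of_disjoint[of j i] that by (cases "i < j") auto
  ultimately show ?thesis
    by (auto simp: nonintersecting_delannoy_tuples_def paths_of_def)
qed

end

lemma inj_on_paths_of:
  assumes n: "n \<ge> 1"
  shows "inj_on (paths_of n) (case1_sequences (2 * n) \<mu>)"
proof (intro inj_onI ext)
  fix \<Lambda> \<Lambda>' d i
  assume L: "\<Lambda> \<in> case1_sequences (2 * n) \<mu>" and L': "\<Lambda>' \<in> case1_sequences (2 * n) \<mu>"
    and eq: "paths_of n \<Lambda> = paths_of n \<Lambda>'"
  show "\<Lambda> d i = \<Lambda>' d i"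
  proof (cases "d < 2 * n \<and> 1 \<le> i \<and> i \<le> (d + 1) div 2")
    case True
    define k where "k = d div 2 + 1"
    have k: "i \<le> k" "k \<le> n" "1 \<le> i" "i \<le> n" "d = 2 * k - 2 \<or> d = 2 * k - 1"
      using True by (auto simp: k_def)
    have "level_path (entry_point \<Lambda> i) (exit_point \<Lambda> i) i n = level_path (entry_point \<Lambda>' i) (exit_point \<Lambda>' i) i n"
      using fun_cong[OF eq, of i] k by (simp add: paths_of_def)
    from level_path_inject[OF this level_steps_case1[OF n L k(3,4)] level_steps_case1[OF n L' k(3,4)] k(1,2)]
    show ?thesis using k(5) by (auto simp: entry_point_def exit_point_def)
  next
    case False
    show ?thesis
    proof (cases "d < 2 * n")
      case True
      then have "i = 0 \<or> i > (d + 1) div 2" using False by auto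
      then show ?thesis
        using L[unfolded case1_sequences_iff[OF n]] L'[unfolded case1_sequences_iff[OF n]] True by auto
    next
      case False
      then show ?thesis using L L' by (auto simp: case1_sequences_def PiE_def extensional_def)
    qed
  qed
qed

text \<open>The entry and exit abscissas of the given paths are shifted back to parts. The order of adjacent
  paths, which disjointness forces by \<open>level_paths_ordered\<close>, is the horizontal strip condition.\<close>

lemma tuple_eq_paths_of:
  assumes n: "n \<ge> 1" and \<mu>0: "\<mu> 0 = 0" and \<mu>: "\<forall>j>n. \<mu> j = 0"
    and p: "p \<in> nonintersecting_delannoy_tuples n \<mu>"
  shows "p \<in> paths_of n ` case1_sequences (2 * n) \<mu>"
proof -
  have "\<forall>i\<in>{1..n}. \<exists>a e. level_steps a e i n \<and> a i = - int i \<and> e n = int (\<mu> i) - int i \<and> p i = level_path a e i n"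
    using p by (auto simp: nonintersecting_delannoy_tuples_def PiE_def Pi_def
        dest!: bspec delannoy_path_eq_level_path)
  then obtain a e where ae: "\<And>i. i \<in> {1..n} \<Longrightarrow> level_steps (a i) (e i) i n"
    "\<And>i. i \<in> {1..n} \<Longrightarrow> a i i = - int i" "\<And>i. i \<in> {1..n} \<Longrightarrow> e i n = int (\<mu> i) - int i"
    "\<And>i. i \<in> {1..n} \<Longrightarrow> p i = level_path (a i) (e i) i n"
    by metis
  have a_ge: "- int i \<le> a i k" if "1 \<le> i" "i \<le> k" "k \<le> n" for i k
    using level_steps_ge[OF ae(1), of i k] ae(2)[of i] that by simp
  have a_le_e: "a i k \<le> e i k" if "1 \<le> i" "i \<le> k" "k \<le> n" for i k
    using ae(1)[of i] that by (simp add: level_steps_def)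
  have up: "a i (Suc k) = e i k \<or> a i (Suc k) = e i k + 1" if "1 \<le> i" "i \<le> k" "k < n" for i k
    using ae(1)[of i] that by (simp add: level_steps_def)
  have ordered: "e (Suc i) k < a i k" if "1 \<le> i" "Suc i \<le> k" "k \<le> n" for i k
  proof (rule level_paths_ordered)
    show "level_steps (a i) (e i) i n" "level_steps (a (Suc i)) (e (Suc i)) (Suc i) n"
      using ae(1) that by auto
    show "set (level_path (a i) (e i) i n) \<inter> set (level_path (a (Suc i)) (e (Suc i)) (Suc i) n) = {}"
      unfolding ae(4)[symmetric] using p that ae(4)[of i, symmetric] ae(4)[of "Suc i", symmetric]
      by (simp add: nonintersecting_delannoy_tuples_def)
    show "a (Suc i) (Suc i) < a i (Suc i)"
      using ae(2)[of "Suc i"] a_ge[of i "Suc i"] that by simp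
  qed (use that in auto)
  \<comment> \<open>Both \<open>d = 2 k - 2\<close> and \<open>d = 2 k - 1\<close> belong to height \<open>k = d div 2 + 1\<close>. Where \<open>i > (d + 1) div 2\<close>
  path \<open>i\<close> has not started or, for \<open>d = 2 i - 2\<close>, is at its initial abscissa, so the part is \<open>0\<close>.\<close>
  define \<Lambda> where "\<Lambda> = restrict (\<lambda>d i. if 1 \<le> i \<and> i \<le> (d + 1) div 2
      then nat ((if even d then a else e) i (d div 2 + 1) + int i) else 0) {0..<2 * n}"
  have even: "int (\<Lambda> (2 * k) i) = (if 1 \<le> i \<and> i \<le> k then a i (Suc k) + int i else 0)" if "k < n" for k i
    using that a_ge[of i "Suc k"] by (auto simp: \<Lambda>_def)
  have odd: "int (\<Lambda> (Suc (2 * k)) i) = (if 1 \<le> i \<and> i \<le> Suc k then e i (Suc k) + int i else 0)" if "k < n" for k i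
    using that a_ge[of i "Suc k"] a_le_e[of i "Suc k"] by (auto simp: \<Lambda>_def)
  have "\<Lambda> \<in> case1_sequences (2 * n) \<mu>"
    unfolding case1_sequences_iff[OF n]
  proof (intro conjI allI impI)
    show "\<Lambda> (2 * n - 1) = \<mu>"
    proof
      fix i
      have "Suc (2 * (n - 1)) = 2 * n - 1" using n by simp
      then have "int (\<Lambda> (2 * n - 1) i) = int (\<mu> i)"
        using odd[of "n - 1" i] n \<mu>0 \<mu> ae(3)[of i] by (cases "i = 0") (auto split: if_splits)
      then show "\<Lambda> (2 * n - 1) i = \<mu> i" by simp
    qed
  next
    fix k i assume k: "k < n" and i: "1 \<le> (i :: nat)"
    have "int (\<Lambda> (2 * k) i) \<le> int (\<Lambda> (2 * k + 1) i)"
      using even[OF k, of i] odd[OF k, of i] a_le_e[of i "Suc k"] a_ge[of i "Suc k"] k i by auto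
    then show "\<Lambda> (2 * k) i \<le> \<Lambda> (2 * k + 1) i" by simp
    have "int (\<Lambda> (2 * k + 1) (Suc i)) \<le> int (\<Lambda> (2 * k) i)"
      using even[OF k, of i] odd[OF k, of "Suc i"] ordered[of i "Suc k"] k i by auto
    then show "\<Lambda> (2 * k + 1) (Suc i) \<le> \<Lambda> (2 * k) i" by simp
  next
    fix k i assume k: "k + 1 < n" and i: "1 \<le> (i :: nat)"
    have "int (\<Lambda> (2 * k + 1) i) \<le> int (\<Lambda> (2 * k + 2) i) \<and> int (\<Lambda> (2 * k + 2) i) \<le> int (\<Lambda> (2 * k + 1) i) + 1"
      using even[of "Suc k" i] odd[of k i] up[of i "Suc k"] k i by auto
    then show "\<Lambda> (2 * k + 1) i \<le> \<Lambda> (2 * k + 2) i" "\<Lambda> (2 * k + 2) i \<le> Suc (\<Lambda> (2 * k + 1) i)"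
      by simp_all
  qed (use n in \<open>auto simp: \<Lambda>_def fun_eq_iff\<close>)
  moreover have "paths_of n \<Lambda> = p"
  proof
    fix i
    show "paths_of n \<Lambda> i = p i"
    proof (cases "i \<in> {1..n}")
      case True
      have "level_path (entry_point \<Lambda> i) (exit_point \<Lambda> i) i n = level_path (a i) (e i) i n"
      proof (rule level_path_cong)
        fix k assume k: "i \<le> k" "k \<le> n"
        obtain l where l: "k = Suc l" using True k by (cases k) auto
        show "entry_point \<Lambda> i k = a i k"
          using even[of l i] k l True ae(2)[OF True] by (cases "i = k") (auto simp: entry_point_def)
        show "exit_point \<Lambda> i k = e i k"
          using odd[of l i] k l True by (auto simp: exit_point_def)
      qed
      then show ?thesis using True ae(4) by (simp add: paths_of_def)
    next
      case False
      then show ?thesis using p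
        by (auto simp: paths_of_def nonintersecting_delannoy_tuples_def PiE_def extensional_def)
    qed
  qed
  ultimately show ?thesis by blast
qed

lemma bij_betw_paths_of:
  assumes "n \<ge> 1" "\<mu> 0 = 0" "\<forall>j>n. \<mu> j = 0"
  shows "bij_betw (paths_of n) (case1_sequences (2 * n) \<mu>) (nonintersecting_delannoy_tuples n \<mu>)"
  unfolding bij_betw_def using assms inj_on_paths_of paths_of_in_tuples tuple_eq_paths_of by blast

section \<open>Domino tilings as matchings of consecutive diagonals\<close>

text \<open>Unit squares are named by their lower left corners, so that tilings can be studied as partitions
  of a set of integer points.\<close>

definition region :: "(int \<times> int) set \<Rightarrow> (real \<times> real) set" where
  "region K = (\<Union>(x, y)\<in>K. unit_square x y)"

lemma centre_in_unit_square_iff: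
  "(real_of_int x + 1 / 2, real_of_int y + 1 / 2) \<in> unit_square a b \<longleftrightarrow> x = a \<and> y = b"
proof -
  have "real_of_int a \<le> real_of_int x + 1 / 2 \<and> real_of_int x + 1 / 2 \<le> real_of_int a + 1 \<longleftrightarrow> x = a" for x a
    by linarith
  then show ?thesis by (simp add: unit_square_def)
qed

lemma in_region_iff: "p \<in> region K \<longleftrightarrow> (\<exists>x y. (x, y) \<in> K \<and> p \<in> unit_square x y)"
  by (auto simp: region_def)

text \<open>The centre of a unit square lies in no other unit square; hence a union of unit squares determines
  the squares (\<open>region_inject\<close>).\<close>

lemma centre_in_region_iff:
  "(real_of_int x + 1 / 2, real_of_int y + 1 / 2) \<in> region K \<longleftrightarrow> (x, y) \<in> K"
  by (simp add: in_region_iff centre_in_unit_square_iff)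

lemma region_inject: "region K = region L \<longleftrightarrow> K = L"
proof
  assume "region K = region L"
  then have "(x, y) \<in> K \<longleftrightarrow> (x, y) \<in> L" for x y
    using centre_in_region_iff[of x y K] centre_in_region_iff[of x y L] by simp
  then show "K = L" by auto
qed simp

lemma region_Union: "region (\<Union>M) = \<Union>(region ` M)"
  by (auto simp: region_def)

text \<open>Two regions with a common square share its interior. Conversely, if the interiors of two regions
  meet in \<open>(x, y)\<close>, then moving this point a little to the upper right reaches a point of both regions
  without integer coordinates; it lies in a single unit square, which then belongs to both.\<close>

lemma interior_region_disjoint_iff:
  "interior (region K) \<inter> interior (region L) = {} \<longleftrightarrow> K \<inter> L = {}"
proof
  assume disj: "interior (region K) \<inter> interior (region L) = {}"
  show "K \<inter> L = {}"
  proof (rule ccontr)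
    assume "K \<inter> L \<noteq> {}"
    then obtain x y where xy: "(x, y) \<in> K" "(x, y) \<in> L" by auto
    let ?B = "{real_of_int x<..<real_of_int x + 1} \<times> {real_of_int y<..<real_of_int y + 1}"
    have "open ?B" by (intro open_Times) auto
    moreover have "?B \<subseteq> region K" "?B \<subseteq> region L"
      using xy by (force simp: region_def unit_square_def)+
    ultimately have "?B \<subseteq> interior (region K) \<inter> interior (region L)"
      by (simp add: interior_maximal)
    moreover have "(real_of_int x + 1 / 2, real_of_int y + 1 / 2) \<in> ?B" by simp
    ultimately show False using disj by blast
  qed
next
  assume disj: "K \<inter> L = {}"
  show "interior (region K) \<inter> interior (region L) = {}"
  proof (rule ccontr)
    let ?I = "interior (region K) \<inter> interior (region L)"
    assume "?I \<noteq> {}"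
    then obtain x y where "(x, y) \<in> ?I" by auto
    moreover have "open ?I" by auto
    ultimately obtain e where e: "e > 0" "ball (x, y) e \<subseteq> ?I"
      using open_contains_ball by blast
    have "0 < real_of_int (\<lfloor>x\<rfloor> + 1) - x" "0 < real_of_int (\<lfloor>y\<rfloor> + 1) - y" by linarith+
    then have "0 < min (e / 2) (min (real_of_int (\<lfloor>x\<rfloor> + 1) - x) (real_of_int (\<lfloor>y\<rfloor> + 1) - y))"
      using e(1) by simp
    then obtain \<delta> where \<delta>': "0 < \<delta>" "\<delta> < min (e / 2) (min (real_of_int (\<lfloor>x\<rfloor> + 1) - x) (real_of_int (\<lfloor>y\<rfloor> + 1) - y))"
      using dense by blast
    then have \<delta>: "0 < \<delta>" "\<delta> < e / 2" "x + \<delta> < real_of_int (\<lfloor>x\<rfloor> + 1)" "y + \<delta> < real_of_int (\<lfloor>y\<rfloor> + 1)"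
      by (simp_all add: less_diff_eq add.commute)
    have "dist (x, y) (x + \<delta>, y + \<delta>) \<le> \<bar>\<delta>\<bar> + \<bar>\<delta>\<bar>"
      using sqrt_sum_squares_le_sum_abs[of \<delta> \<delta>] by (simp add: dist_Pair_Pair dist_real_def)
    also have "\<dots> < e" using \<delta> e by simp
    finally have "(x + \<delta>, y + \<delta>) \<in> ?I" using e by auto
    then have "(x + \<delta>, y + \<delta>) \<in> region K" "(x + \<delta>, y + \<delta>) \<in> region L"
      using interior_subset by blast+
    moreover have "(\<lfloor>x\<rfloor>, \<lfloor>y\<rfloor>) \<in> J" if in_J: "(x + \<delta>, y + \<delta>) \<in> region J" for J
    proof -
      obtain a b where ab: "(a, b) \<in> J" "(x + \<delta>, y + \<delta>) \<in> unit_square a b"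
        using in_J by (auto simp: region_def)
      have "real_of_int \<lfloor>x\<rfloor> < x + \<delta>" "real_of_int \<lfloor>y\<rfloor> < y + \<delta>" using \<delta>(1) by linarith+
      then have "\<lfloor>x\<rfloor> = a" "\<lfloor>y\<rfloor> = b"
        using ab(2) \<delta>(3,4) by (auto simp: unit_square_def)
      with ab(1) show ?thesis by simp
    qed
    ultimately show False using disj by blast
  qed
qed

definition cell_domino :: "(int \<times> int) set \<Rightarrow> bool" where
  "cell_domino K \<longleftrightarrow> (\<exists>x y. K = {(x, y), (x + 1, y)} \<or> K = {(x, y), (x, y + 1)})"

definition cell_tilings :: "(int \<times> int) set \<Rightarrow> (int \<times> int) set set set" where
  "cell_tilings C =
     {M. (\<forall>K\<in>M. cell_domino K) \<and> (\<forall>K\<in>M. \<forall>L\<in>M. K \<noteq> L \<longrightarrow> K \<inter> L = {}) \<and> \<Union>M = C}"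

lemma is_domino_iff: "is_domino t \<longleftrightarrow> (\<exists>K. cell_domino K \<and> t = region K)"
proof -
  have "region {(a, b), (c, d)} = unit_square a b \<union> unit_square c d" for a b c d
    by (simp add: region_def)
  then show ?thesis unfolding is_domino_def cell_domino_def by metis
qed

lemma bij_betw_cell_tilings:
  "bij_betw (image region) (cell_tilings C) (domino_tilings (region C))"
proof (intro bij_betw_imageI equalityI subsetI)
  show "inj_on (image region) (cell_tilings C)"
    by (rule inj_onI) (simp add: inj_image_eq_iff inj_def region_inject)
next
  fix \<T> assume "\<T> \<in> image region ` cell_tilings C"
  then obtain M where M: "M \<in> cell_tilings C" and T: "\<T> = region ` M" by blast
  have "interior (region K) \<inter> interior (region L) = {}" if "K \<in> M" "L \<in> M" "region K \<noteq> region L" for K L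
  proof -
    have "K \<noteq> L" using that(3) by blast
    then show ?thesis using M that(1,2) by (simp add: interior_region_disjoint_iff cell_tilings_def)
  qed
  then show "\<T> \<in> domino_tilings (region C)"
    using M by (auto simp: T cell_tilings_def domino_tilings_def is_domino_iff region_Union)
next
  fix \<T> assume T: "\<T> \<in> domino_tilings (region C)"
  define M where "M = {K. cell_domino K \<and> region K \<in> \<T>}"
  have TM: "\<T> = region ` M"
    using T by (auto simp: M_def domino_tilings_def is_domino_iff)
  then have "region (\<Union>M) = region C"
    using T by (simp add: region_Union domino_tilings_def)
  then have "\<Union>M = C" by (simp add: region_inject)
  moreover have "K \<inter> L = {}" if "K \<in> M" "L \<in> M" "K \<noteq> L" for K L
  proof -
    have "interior (region K) \<inter> interior (region L) = {}"
      using T that by (simp add: domino_tilings_def M_def region_inject)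
    then show ?thesis by (simp add: interior_region_disjoint_iff)
  qed
  ultimately have "M \<in> cell_tilings C" by (auto simp: cell_tilings_def M_def)
  with TM show "\<T> \<in> image region ` cell_tilings C" by blast
qed

text \<open>The lower left corner of the square \<open>Q (c, d)\<close>.\<close>

definition corner :: "nat \<Rightarrow> nat \<Rightarrow> int \<times> int" where
  "corner c d = (int c, int c - int d)"

text \<open>The domino made of \<open>Q (c, d)\<close> and \<open>Q (c', d + 1)\<close>; it is a domino for \<open>c' \<in> {c, c + 1}\<close>.\<close>

definition link :: "nat \<Rightarrow> nat \<Rightarrow> nat \<Rightarrow> (int \<times> int) set" where
  "link d c c' = {corner c d, corner c' (Suc d)}"

definition level_cells :: "(nat \<Rightarrow> nat set) \<Rightarrow> (int \<times> int) set" where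
  "level_cells C = {corner c d |c d. c \<in> C d}"

text \<open>The neighbours of \<open>Q (c, d)\<close> on diagonal \<open>d + 1\<close> have positions \<open>c\<close> and \<open>c + 1\<close>, so the dominoes
  between these two diagonals are the pairs \<open>(c, f c)\<close> of such a matching.\<close>

definition shift_matching :: "(nat \<Rightarrow> nat) \<Rightarrow> nat set \<Rightarrow> nat set \<Rightarrow> bool" where
  "shift_matching f A B \<longleftrightarrow> bij_betw f A B \<and> (\<forall>c\<in>A. f c = c \<or> f c = Suc c)"

text \<open>The records of a tiling: \<open>U d\<close> holds the squares of diagonal \<open>d\<close> that are joined to diagonal \<open>d + 1\<close>.
  The first diagonal has no predecessor, so all of it must be joined upwards.\<close>

definition upward_sequences :: "(nat \<Rightarrow> nat set) \<Rightarrow> (nat \<Rightarrow> nat set) set" where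
  "upward_sequences C =
     {U. U 0 = C 0 \<and> (\<forall>d. U d \<subseteq> C d) \<and>
         (\<forall>d. \<exists>f. shift_matching f (U d) (C (Suc d) - U (Suc d)))}"

definition upward :: "(int \<times> int) set set \<Rightarrow> nat \<Rightarrow> nat set" where
  "upward M d = {c. \<exists>c'. link d c c' \<in> M}"

lemma corner_inject [simp]: "corner c d = corner c' d' \<longleftrightarrow> c = c' \<and> d = d'"
  by (auto simp: corner_def)

lemma corner_in_link_iff:
  "corner c d \<in> link e a b \<longleftrightarrow> c = a \<and> d = e \<or> c = b \<and> d = Suc e"
  by (simp add: link_def)

lemma link_inject: "link d c c' = link e a b \<longleftrightarrow> d = e \<and> c = a \<and> c' = b"
  by (auto simp: link_def doubleton_eq_iff)

lemma corner_in_level_cells [simp]: "corner c d \<in> level_cells C \<longleftrightarrow> c \<in> C d"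
  by (auto simp: level_cells_def)

lemma cell_domino_link:
  assumes "c' = c \<or> c' = Suc c"
  shows "cell_domino (link d c c')"
proof (cases "c' = c")
  case True
  then have "link d c c' = {(int c, int c - int d - 1), (int c, int c - int d - 1 + 1)}"
    by (auto simp: link_def corner_def)
  then show ?thesis unfolding cell_domino_def by blast
next
  case False
  then have "link d c c' = {(int c, int c - int d), (int c + 1, int c - int d)}"
    using assms by (auto simp: link_def corner_def)
  then show ?thesis unfolding cell_domino_def by blast
qed

lemma cell_domino_in_levels:
  assumes "cell_domino K" "K \<subseteq> level_cells C"
  obtains d c c' where "K = link d c c'" "c' = c \<or> c' = Suc c"
proof -
  obtain x y where "K = {(x, y), (x + 1, y)} \<or> K = {(x, y), (x, y + 1)}"
    using assms(1) by (auto simp: cell_domino_def)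
  then show thesis
  proof
    assume K: "K = {(x, y), (x + 1, y)}"
    then obtain c d c' d' where "(x, y) = corner c d" "(x + 1, y) = corner c' d'"
      using assms(2) by (auto simp: level_cells_def)
    moreover from this have "c' = Suc c" "d' = Suc d" by (auto simp: corner_def)
    ultimately show thesis using K by (intro that[of d c c']) (auto simp: link_def)
  next
    assume K: "K = {(x, y), (x, y + 1)}"
    then obtain c d c' d' where "(x, y) = corner c d" "(x, y + 1) = corner c' d'"
      using assms(2) by (auto simp: level_cells_def)
    moreover from this have "c' = c" "d = Suc d'" by (auto simp: corner_def)
    ultimately show thesis using K by (intro that[of d' c' c]) (auto simp: link_def)
  qed
qed

text \<open>At the least \<open>c\<close> where two shift matchings differ, one of them fixes \<open>c\<close> and the other one moves it to
  \<open>c + 1\<close>. The second one must reach \<open>c\<close> from \<open>c - 1\<close>, and there it agrees with the first one, which is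
  then not injective.\<close>

lemma shift_matching_unique:
  assumes f: "shift_matching f A B" and g: "shift_matching g A B" and "c \<in> A"
  shows "f c = g c"
  using \<open>c \<in> A\<close>
proof (induction c rule: less_induct)
  case (less c)
  have stay: "g' c = c"
    if f': "shift_matching f' A B" and g': "shift_matching g' A B" and "f' c = c"
      and IH: "\<And>b. b < c \<Longrightarrow> b \<in> A \<Longrightarrow> f' b = g' b" for f' g'
  proof -
    have "f' c \<in> B" using f' less.prems by (auto simp: shift_matching_def bij_betw_def)
    then have "c \<in> B" using \<open>f' c = c\<close> by simp
    then obtain b where b: "b \<in> A" "g' b = c"
      using g' by (auto simp: shift_matching_def bij_betw_def)
    then have "b = c \<or> b < c" using g' by (auto simp: shift_matching_def)
    moreover have "\<not> b < c"
    proof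
      assume "b < c"
      then have "f' b = f' c" using IH b \<open>f' c = c\<close> by simp
      then show False
        using f' b less.prems \<open>b < c\<close> by (auto simp: shift_matching_def bij_betw_def dest: inj_onD)
    qed
    ultimately show "g' c = c" using b by simp
  qed
  have "f c = c \<or> f c = Suc c" "g c = c \<or> g c = Suc c"
    using f g less.prems by (auto simp: shift_matching_def)
  moreover have "f c = c \<Longrightarrow> g c = c" "g c = c \<Longrightarrow> f c = c"
    using stay[OF f g] stay[OF g f] less.IH by simp_all
  ultimately show ?case by auto
qed

text \<open>Each square lies in one domino, so the partner of an upward square is a function of the square, and
  the squares of diagonal \<open>d + 1\<close> which are not joined upwards are its values.\<close>

lemma cell_tiling_links:
  assumes M: "M \<in> cell_tilings (level_cells C)"
  obtains f where "\<And>d. shift_matching (f d) (upward M d) (C (Suc d) - upward M (Suc d))"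
    "M = {link d c (f d c) |d c. c \<in> upward M d}"
proof -
  have link: "\<exists>d c c'. K = link d c c' \<and> (c' = c \<or> c' = Suc c) \<and> c \<in> C d \<and> c' \<in> C (Suc d)"
    if "K \<in> M" for K
  proof -
    have "cell_domino K" and sub: "K \<subseteq> level_cells C" using M that by (auto simp: cell_tilings_def)
    then obtain d c c' where K: "K = link d c c'" "c' = c \<or> c' = Suc c"
      by (rule cell_domino_in_levels)
    moreover have "c \<in> C d" "c' \<in> C (Suc d)" using sub K(1) by (auto simp: link_def)
    ultimately show ?thesis by blast
  qed
  have linkD: "c' = c \<or> c' = Suc c" "c \<in> C d" "c' \<in> C (Suc d)" if "link d c c' \<in> M" for d c c'
    using link[OF that] by (auto simp: link_inject)
  have same: "K = L" if "K \<in> M" "L \<in> M" "z \<in> K" "z \<in> L" for K L z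
    using M that by (auto simp: cell_tilings_def)
  define f where "f d c = (SOME c'. link d c c' \<in> M)" for d c
  have f: "link d c (f d c) \<in> M" if "c \<in> upward M d" for d c
    using that unfolding upward_def f_def by (auto intro: someI)
  have fI: "c \<in> upward M d \<and> c' = f d c" if "link d c c' \<in> M" for d c c'
  proof -
    have c: "c \<in> upward M d" using that by (auto simp: upward_def)
    have "link d c c' = link d c (f d c)"
      using that f[OF c] by (rule same[of _ _ "corner c d"]) (simp_all add: link_def)
    with c show ?thesis by (simp add: link_inject)
  qed
  show thesis
  proof
    show "shift_matching (f d) (upward M d) (C (Suc d) - upward M (Suc d))" for d
      unfolding shift_matching_def
    proof (intro conjI ballI bij_betw_imageI equalityI subsetI)
      show "inj_on (f d) (upward M d)"
      proof (rule inj_onI)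
        fix a b assume ab: "a \<in> upward M d" "b \<in> upward M d" "f d a = f d b"
        have "link d a (f d a) = link d b (f d b)"
          using f[OF ab(1)] f[OF ab(2)] by (rule same[of _ _ "corner (f d a) (Suc d)"]) (simp_all add: link_def ab(3))
        then show "a = b" by (simp add: link_inject)
      qed
    next
      fix c' assume "c' \<in> f d ` upward M d"
      then obtain c where c: "link d c c' \<in> M" using f by auto
      moreover have "c' \<notin> upward M (Suc d)"
      proof
        assume "c' \<in> upward M (Suc d)"
        then obtain c'' where c'': "link (Suc d) c' c'' \<in> M" by (auto simp: upward_def)
        have "link d c c' = link (Suc d) c' c''"
          using c c'' by (rule same[of _ _ "corner c' (Suc d)"]) (simp_all add: link_def)
        then show False by (simp add: link_inject)
      qed
      ultimately show "c' \<in> C (Suc d) - upward M (Suc d)" using linkD by blast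
    next
      fix c' assume c': "c' \<in> C (Suc d) - upward M (Suc d)"
      then have "corner c' (Suc d) \<in> \<Union>M" using M by (simp add: cell_tilings_def)
      then obtain K where K: "K \<in> M" "corner c' (Suc d) \<in> K" by blast
      then obtain e a b where e: "K = link e a b" using link by blast
      then have "e = d \<and> b = c'" using K c' by (auto simp: corner_in_link_iff upward_def)
      then show "c' \<in> f d ` upward M d" using fI[of d a b] K e by auto
    next
      fix c assume "c \<in> upward M d"
      then show "f d c = c \<or> f d c = Suc c" using linkD f by blast
    qed
    show "M = {link d c (f d c) |d c. c \<in> upward M d}"
    proof (intro equalityI subsetI)
      fix K assume "K \<in> M"
      then obtain d c c' where "K = link d c c'" using link by blast
      then show "K \<in> {link d c (f d c) |d c. c \<in> upward M d}" using fI \<open>K \<in> M\<close> by blast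
    qed (use f in auto)
  qed
qed

text \<open>Existence of the matchings in \<^const>\<open>upward_sequences\<close> yields a tiling; their uniqueness makes it the
  only one.\<close>

lemma bij_betw_upward:
  "bij_betw upward (cell_tilings (level_cells C)) (upward_sequences C)"
proof (intro bij_betw_imageI equalityI subsetI)
  show "inj_on upward (cell_tilings (level_cells C))"
  proof (rule inj_onI)
    fix M M' assume M: "M \<in> cell_tilings (level_cells C)" and M': "M' \<in> cell_tilings (level_cells C)"
      and eq: "upward M = upward M'"
    obtain f where f: "\<And>d. shift_matching (f d) (upward M d) (C (Suc d) - upward M (Suc d))"
      "M = {link d c (f d c) |d c. c \<in> upward M d}" using cell_tiling_links[OF M] by blast
    obtain f' where f': "\<And>d. shift_matching (f' d) (upward M' d) (C (Suc d) - upward M' (Suc d))"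
      "M' = {link d c (f' d c) |d c. c \<in> upward M' d}" using cell_tiling_links[OF M'] by blast
    have "f d c = f' d c" if "c \<in> upward M d" for d c
      using shift_matching_unique[OF f(1) _ that, of "f' d"] f'(1)[of d] eq by simp
    then show "M = M'"
      by (subst f(2), subst f'(2)) (use eq in force)
  qed
next
  fix U assume "U \<in> upward ` cell_tilings (level_cells C)"
  then obtain M where M: "M \<in> cell_tilings (level_cells C)" and U: "U = upward M" by blast
  obtain f where f: "\<And>d. shift_matching (f d) (upward M d) (C (Suc d) - upward M (Suc d))"
    "M = {link d c (f d c) |d c. c \<in> upward M d}" using cell_tiling_links[OF M] by blast
  have cover: "\<Union>M = level_cells C" using M by (simp add: cell_tilings_def)
  have sub: "upward M d \<subseteq> C d" for d
  proof
    fix c assume "c \<in> upward M d"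
    then obtain c' where "link d c c' \<in> M" by (auto simp: upward_def)
    then have "corner c d \<in> \<Union>M" by (auto simp: link_def)
    then show "c \<in> C d" by (simp add: cover)
  qed
  moreover have "C 0 \<subseteq> upward M 0"
  proof
    fix c assume "c \<in> C 0"
    then have "corner c 0 \<in> \<Union>M" by (simp add: cover)
    then obtain K where "K \<in> M" "corner c 0 \<in> K" by blast
    moreover obtain e a where "K = link e a (f e a)" using f(2) \<open>K \<in> M\<close> by blast
    ultimately show "c \<in> upward M 0" by (auto simp: corner_in_link_iff upward_def)
  qed
  ultimately have "upward M 0 = C 0" by blast
  moreover have "\<forall>d. \<exists>f. shift_matching f (upward M d) (C (Suc d) - upward M (Suc d))"
    using f(1) by blast
  ultimately show "U \<in> upward_sequences C"
    using sub U by (simp add: upward_sequences_def)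
next
  fix U assume U: "U \<in> upward_sequences C"
  then obtain f where f: "\<And>d. shift_matching (f d) (U d) (C (Suc d) - U (Suc d))"
    unfolding upward_sequences_def mem_Collect_eq by metis
  have U0: "U 0 = C 0" and sub: "\<And>d. U d \<subseteq> C d" using U by (auto simp: upward_sequences_def)
  have f_inj: "c = c'" if "c \<in> U d" "c' \<in> U d" "f d c = f d c'" for c c' d
    using f[of d] that by (auto simp: shift_matching_def bij_betw_def dest: inj_onD)
  have f_image: "f d ` U d = C (Suc d) - U (Suc d)" for d
    using f[of d] by (simp add: shift_matching_def bij_betw_def)
  define M where "M = {link d c (f d c) |d c. c \<in> U d}"
  have "M \<in> cell_tilings (level_cells C)"
    unfolding cell_tilings_def mem_Collect_eq
  proof (intro conjI ballI impI)
    fix K assume "K \<in> M"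
    then show "cell_domino K"
      using f by (auto simp: M_def shift_matching_def intro!: cell_domino_link)
  next
    fix K L assume "K \<in> M" "L \<in> M" "K \<noteq> L"
    then obtain d c e a where KL: "K = link d c (f d c)" "c \<in> U d" "L = link e a (f e a)" "a \<in> U e"
      by (auto simp: M_def)
    have "f d c \<notin> U (Suc d)" "f e a \<notin> U (Suc e)" using f_image KL by blast+
    then have "K = L" if "z \<in> K" "z \<in> L" for z
      using that KL f_inj by (auto simp: link_def)
    with \<open>K \<noteq> L\<close> show "K \<inter> L = {}" by blast
  next
    show "\<Union>M = level_cells C"
    proof (intro equalityI subsetI)
      fix z assume "z \<in> \<Union>M"
      then obtain d c where "c \<in> U d" "z = corner c d \<or> z = corner (f d c) (Suc d)"
        by (auto simp: M_def link_def)
      moreover have "c \<in> C d" "f d c \<in> C (Suc d)" using sub f_image \<open>c \<in> U d\<close> by blast+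
      ultimately show "z \<in> level_cells C" by auto
    next
      fix z assume "z \<in> level_cells C"
      then obtain c d where z: "z = corner c d" "c \<in> C d" by (auto simp: level_cells_def)
      show "z \<in> \<Union>M"
      proof (cases "c \<in> U d")
        case True
        then have "link d c (f d c) \<in> M" by (auto simp: M_def)
        then show ?thesis using z by (auto simp: link_def)
      next
        case False
        then obtain e where e: "d = Suc e" using z U0 by (cases d) auto
        then have "c \<in> f e ` U e" using f_image z False by simp
        then obtain b where "b \<in> U e" "c = f e b" by blast
        then have "link e b c \<in> M" "z \<in> link e b c" using e z by (auto simp: M_def link_def)
        then show ?thesis by blast
      qed
    qed
  qed
  moreover have "upward M = U"
    by (auto simp: upward_def M_def link_inject fun_eq_iff)
  ultimately show "U \<in> upward ` cell_tilings (level_cells C)" by blast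
qed

section \<open>Maya diagrams and shift matchings\<close>

text \<open>The map \<open>j \<mapsto> \<nu> j + k - j\<close> is strictly decreasing on \<open>{1..k}\<close>, so the set of its values encodes a
  partition with at most \<open>k\<close> parts.\<close>

definition maya :: "nat \<Rightarrow> (nat \<Rightarrow> nat) \<Rightarrow> nat set" where
  "maya k \<nu> = {\<nu> j + k - j |j. 1 \<le> j \<and> j \<le> k}"

definition partition_parts :: "nat \<Rightarrow> (nat \<Rightarrow> nat) set" where
  "partition_parts k = {\<nu>. is_partition \<nu> \<and> (\<forall>j>k. \<nu> j = 0)}"

definition count_ge :: "nat set \<Rightarrow> nat \<Rightarrow> nat" where
  "count_ge X x = card {c \<in> X. x \<le> c}"

lemma maya_image: "maya k \<nu> = (\<lambda>j. \<nu> j + k - j) ` {1..k}"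
  by (auto simp: maya_def)

lemma finite_maya [simp]: "finite (maya k \<nu>)"
  by (simp add: maya_image)

lemma maya_strict_decreasing:
  assumes "\<nu> \<in> partition_parts k" "1 \<le> i" "i < j" "j \<le> k"
  shows "\<nu> j + k - j < \<nu> i + k - i"
proof -
  have "\<nu> j \<le> \<nu> i" using assms by (simp add: partition_parts_def is_partition_def)
  then show ?thesis using assms by linarith
qed

lemma maya_inj_on:
  assumes "\<nu> \<in> partition_parts k"
  shows "inj_on (\<lambda>j. \<nu> j + k - j) {1..k}"
  by (rule linorder_inj_onI) (use maya_strict_decreasing[OF assms] in force)+

lemma card_maya: "\<nu> \<in> partition_parts k \<Longrightarrow> card (maya k \<nu>) = k"
  unfolding maya_image by (subst card_image[OF maya_inj_on]) simp_all

text \<open>As the elements of the Maya diagram are listed in decreasing order, at least \<open>j\<close> of them are \<open>\<ge> x\<close>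
  exactly when the \<open>j\<close>-th one is. This adjunction turns inequalities between parts into inequalities
  between counting functions and back; the latter behave well under complements.\<close>

lemma count_ge_maya_iff:
  assumes \<nu>: "\<nu> \<in> partition_parts k" and j: "1 \<le> j" "j \<le> k"
  shows "j \<le> count_ge (maya k \<nu>) x \<longleftrightarrow> x \<le> \<nu> j + k - j"
proof -
  let ?g = "\<lambda>j. \<nu> j + k - j"
  let ?J = "{i \<in> {1..k}. x \<le> ?g i}"
  have "?J = {1..card ?J}"
  proof (rule initial_segment_of_down_closed)
    fix i i' assume i: "i' \<in> ?J" "1 \<le> i" "i \<le> i'"
    have "?g i' \<le> ?g i"
      using maya_strict_decreasing[OF \<nu>, of i i'] i by (cases "i = i'") auto
    then show "i \<in> ?J" using i by auto
  qed auto
  moreover have "count_ge (maya k \<nu>) x = card ?J"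
  proof -
    have "{c \<in> maya k \<nu>. x \<le> c} = ?g ` ?J" by (auto simp: maya_image)
    moreover have "inj_on ?g ?J" using maya_inj_on[OF \<nu>] by (rule inj_on_subset) auto
    ultimately show ?thesis by (simp add: count_ge_def card_image)
  qed
  ultimately have "j \<in> ?J \<longleftrightarrow> j \<in> {1..count_ge (maya k \<nu>) x}" by simp
  then show ?thesis using j by simp
qed

lemma count_ge_le_card: "finite X \<Longrightarrow> count_ge X x \<le> card X"
  unfolding count_ge_def by (rule card_mono) auto

lemma maya_inject:
  assumes \<alpha>: "\<alpha> \<in> partition_parts k" and \<beta>: "\<beta> \<in> partition_parts k" and eq: "maya k \<alpha> = maya k \<beta>"
  shows "\<alpha> = \<beta>"
proof
  fix j
  show "\<alpha> j = \<beta> j"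
  proof (cases "1 \<le> j \<and> j \<le> k")
    case True
    then have "x \<le> \<alpha> j + k - j \<longleftrightarrow> x \<le> \<beta> j + k - j" for x
      using count_ge_maya_iff[OF \<alpha>, of j x] count_ge_maya_iff[OF \<beta>, of j x] eq by simp
    then have "\<alpha> j + k - j = \<beta> j + k - j" by (meson order_antisym order_refl)
    then show ?thesis using True by linarith
  next
    case False
    then have "j = 0 \<or> j > k" by auto
    then show ?thesis using \<alpha> \<beta> by (auto simp: partition_parts_def is_partition_def)
  qed
qed

text \<open>The largest element \<open>m\<close> of a set with \<open>k + 1\<close> elements gives the first part \<open>m - k\<close>; the other elements
  give the remaining parts by induction.\<close>

lemma maya_surj:
  assumes "finite X" "card X = k"
  shows "\<exists>\<nu>\<in>partition_parts k. maya k \<nu> = X"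
  using assms
proof (induction k arbitrary: X)
  case 0
  then show ?case
    by (intro bexI[of _ "\<lambda>_. 0"]) (auto simp: maya_def partition_parts_def is_partition_def)
next
  case (Suc k)
  define m where "m = Max X"
  have "X \<noteq> {}" using Suc.prems by auto
  then have X: "m \<in> X" "\<And>x. x \<in> X \<Longrightarrow> x \<le> m"
    using Suc.prems by (simp_all add: m_def)
  have "X \<subseteq> {..m}" using X(2) by auto
  then have "card X \<le> card {..m}" by (intro card_mono) auto
  then have km: "k \<le> m" using Suc.prems by simp
  obtain \<kappa> where \<kappa>: "\<kappa> \<in> partition_parts k" "maya k \<kappa> = X - {m}"
    using Suc.IH[of "X - {m}"] Suc.prems X(1) by auto
  define \<nu> where "\<nu> j = (if j = 0 then 0 else if j = 1 then m - k else \<kappa> (j - 1))" for j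
  have first: "\<kappa> 1 \<le> m - k"
  proof (cases "k = 0")
    case True
    then show ?thesis using \<kappa>(1) by (simp add: partition_parts_def)
  next
    case False
    then have "\<kappa> 1 + k - 1 \<in> maya k \<kappa>" unfolding maya_def by force
    then have "\<kappa> 1 + k - 1 < m" using \<kappa>(2) X(2) by (simp add: le_neq_implies_less)
    then show ?thesis using False by simp
  qed
  have "is_partition \<nu>"
  proof (rule is_partitionI[of _ "Suc k"])
    show "\<nu> (Suc j) \<le> \<nu> j" if "1 \<le> j" for j
      using \<kappa>(1) first that by (auto simp: \<nu>_def partition_parts_def is_partition_def)
  qed (use \<kappa>(1) in \<open>auto simp: \<nu>_def partition_parts_def\<close>)
  moreover have "\<forall>j>Suc k. \<nu> j = 0" using \<kappa>(1) by (auto simp: \<nu>_def partition_parts_def)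
  moreover have "maya (Suc k) \<nu> = X"
  proof -
    have "maya (Suc k) \<nu> = insert (\<nu> 1 + Suc k - 1) ((\<lambda>j. \<nu> j + Suc k - j) ` Suc ` {1..k})"
    proof -
      have "{1..Suc k} = insert 1 (Suc ` {1..k})" by (auto simp: image_iff Bex_def)
      then show ?thesis by (simp add: maya_image)
    qed
    also have "\<dots> = insert m (maya k \<kappa>)"
      unfolding maya_image image_image using km
      by (intro arg_cong2[of _ _ _ _ insert] image_cong) (auto simp: \<nu>_def)
    finally show ?thesis using \<kappa>(2) X(1) by auto
  qed
  ultimately show ?case by (auto simp: partition_parts_def)
qed

text \<open>A shift matching moves no element down and none up by more than one, which bounds the counting
  functions by each other. Conversely these bounds say, by \<open>count_ge_maya_iff\<close>, that the \<open>j\<close>-th largest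
  elements of \<open>A\<close> and \<open>B\<close> differ by \<open>0\<close> or \<open>1\<close>, and matching them in order works.\<close>

lemma shift_matching_exists_iff:
  assumes "finite A" "finite B"
  shows "(\<exists>f. shift_matching f A B) \<longleftrightarrow>
    card A = card B \<and> (\<forall>x. count_ge A x \<le> count_ge B x \<and> count_ge B (Suc x) \<le> count_ge A x)"
proof
  assume "\<exists>f. shift_matching f A B"
  then obtain f where f: "bij_betw f A B" "\<And>c. c \<in> A \<Longrightarrow> f c = c \<or> f c = Suc c"
    by (auto simp: shift_matching_def)
  have "count_ge A x \<le> count_ge B x" for x
    unfolding count_ge_def
  proof (rule card_inj_on_le)
    show "inj_on f {c \<in> A. x \<le> c}" using f(1) by (auto simp: bij_betw_def intro: inj_on_subset)
    show "f ` {c \<in> A. x \<le> c} \<subseteq> {c \<in> B. x \<le> c}"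
      using f by (fastforce simp: bij_betw_def)
  qed (use assms in auto)
  moreover have "count_ge B (Suc x) \<le> count_ge A x" for x
    unfolding count_ge_def
  proof (rule surj_card_le)
    show "{c \<in> B. Suc x \<le> c} \<subseteq> f ` {c \<in> A. x \<le> c}"
      using f by (fastforce simp: bij_betw_def)
  qed (use assms in auto)
  ultimately show "card A = card B \<and> (\<forall>x. count_ge A x \<le> count_ge B x \<and> count_ge B (Suc x) \<le> count_ge A x)"
    using bij_betw_same_card[OF f(1)] by simp
next
  assume R: "card A = card B \<and> (\<forall>x. count_ge A x \<le> count_ge B x \<and> count_ge B (Suc x) \<le> count_ge A x)"
  define k where "k = card A"
  obtain \<alpha> where \<alpha>: "\<alpha> \<in> partition_parts k" "maya k \<alpha> = A" using maya_surj[of A k] assms k_def by auto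
  obtain \<beta> where \<beta>: "\<beta> \<in> partition_parts k" "maya k \<beta> = B" using maya_surj[of B k] assms k_def R by auto
  let ?a = "\<lambda>j. \<alpha> j + k - j" and ?b = "\<lambda>j. \<beta> j + k - j"
  have a: "bij_betw ?a {1..k} A" and b: "bij_betw ?b {1..k} B"
    unfolding bij_betw_def using maya_inj_on \<alpha> \<beta> by (auto simp: maya_image)
  have shift: "?b j = ?a j \<or> ?b j = Suc (?a j)" if j: "j \<in> {1..k}" for j
  proof -
    have iff: "j \<le> count_ge A x \<longleftrightarrow> x \<le> ?a j" "j \<le> count_ge B x \<longleftrightarrow> x \<le> ?b j" for x
      using count_ge_maya_iff[OF \<alpha>(1)] count_ge_maya_iff[OF \<beta>(1)] \<alpha>(2) \<beta>(2) j by auto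
    have "j \<le> count_ge A (?a j)" using iff(1) by blast
    then have "j \<le> count_ge B (?a j)" using R le_trans by blast
    then have "?a j \<le> ?b j" using iff(2) by blast
    moreover have "?b j \<le> Suc (?a j)"
    proof (cases "?b j")
      case (Suc x)
      have "j \<le> count_ge B (Suc x)" using iff(2) Suc by (metis order_refl)
      then have "j \<le> count_ge A x" using R le_trans by blast
      then have "x \<le> ?a j" using iff(1) by blast
      then show ?thesis using Suc by simp
    qed simp
    ultimately show ?thesis by auto
  qed
  define f where "f = ?b \<circ> the_inv_into {1..k} ?a"
  have "bij_betw f A B"
    unfolding f_def using bij_betw_the_inv_into[OF a] b by (rule bij_betw_trans)
  moreover have "f c = c \<or> f c = Suc c" if "c \<in> A" for c
  proof -
    obtain j where j: "j \<in> {1..k}" "c = ?a j" using a \<open>c \<in> A\<close> by (auto simp: bij_betw_def)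
    then have "the_inv_into {1..k} ?a c = j"
      using a by (auto simp: bij_betw_def intro: the_inv_into_f_f)
    then show ?thesis using shift j by (simp add: f_def)
  qed
  ultimately show "\<exists>f. shift_matching f A B" unfolding shift_matching_def by blast
qed

text \<open>A form of the comparison of two numbers to which \<open>count_ge_maya_iff\<close> applies.\<close>

lemma le_via_thresholds:
  fixes G H m :: nat
  assumes "G \<le> m" "\<And>j. 1 \<le> j \<Longrightarrow> j \<le> m \<Longrightarrow> j \<le> G \<Longrightarrow> j \<le> H"
  shows "G \<le> H"
  using assms(2)[of G] assms(1) by (cases "G = 0") auto

lemma count_ge_maya_le: "\<nu> \<in> partition_parts k \<Longrightarrow> count_ge (maya k \<nu>) x \<le> k"
  using count_ge_le_card[of "maya k \<nu>" x] by (simp add: card_maya)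

lemma vertical_shift_matching_iff:
  assumes \<alpha>: "\<alpha> \<in> partition_parts k" and \<beta>: "\<beta> \<in> partition_parts k"
  shows "(\<exists>f. shift_matching f (maya k \<alpha>) (maya k \<beta>)) \<longleftrightarrow> (\<forall>j\<ge>1. \<alpha> j \<le> \<beta> j \<and> \<beta> j \<le> Suc (\<alpha> j))"
  (is "?L \<longleftrightarrow> ?R")
proof -
  let ?A = "count_ge (maya k \<alpha>)" and ?B = "count_ge (maya k \<beta>)"
  note A = count_ge_maya_iff[OF \<alpha>] and B = count_ge_maya_iff[OF \<beta>]
  have "?L \<longleftrightarrow> (\<forall>x. ?A x \<le> ?B x \<and> ?B (Suc x) \<le> ?A x)"
    by (simp add: shift_matching_exists_iff card_maya \<alpha> \<beta>)
  also have "\<dots> \<longleftrightarrow> ?R"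
  proof
    assume L: "\<forall>x. ?A x \<le> ?B x \<and> ?B (Suc x) \<le> ?A x"
    show ?R
    proof (intro allI impI)
      fix j :: nat assume j: "1 \<le> j"
      show "\<alpha> j \<le> \<beta> j \<and> \<beta> j \<le> Suc (\<alpha> j)"
      proof (cases "j \<le> k")
        case True
        let ?a = "\<alpha> j + k - j" and ?b = "\<beta> j + k - j"
        have "j \<le> ?A ?a" using A[OF j True] by blast
        then have "j \<le> ?B ?a" using L le_trans by blast
        then have "?a \<le> ?b" using B[OF j True] by blast
        moreover have "?b \<le> Suc ?a"
        proof (cases ?b)
          case (Suc x)
          then have "j \<le> ?B (Suc x)" using B[OF j True] by simp
          then have "j \<le> ?A x" using L le_trans by blast
          then show ?thesis using A[OF j True] Suc by simp
        qed simp
        ultimately show ?thesis using True by linarith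
      next
        case False
        then show ?thesis using \<alpha> \<beta> by (simp add: partition_parts_def)
      qed
    qed
  next
    assume R: ?R
    show "\<forall>x. ?A x \<le> ?B x \<and> ?B (Suc x) \<le> ?A x"
    proof (intro allI conjI)
      fix x
      show "?A x \<le> ?B x"
      proof (rule le_via_thresholds[OF count_ge_maya_le[OF \<alpha>]])
        fix j assume j: "1 \<le> j" "j \<le> k" "j \<le> ?A x"
        have "\<alpha> j \<le> \<beta> j" using R j by blast
        then show "j \<le> ?B x" using A[OF j(1,2), of x] B[OF j(1,2), of x] j by linarith
      qed
      show "?B (Suc x) \<le> ?A x"
      proof (rule le_via_thresholds[OF count_ge_maya_le[OF \<beta>]])
        fix j assume j: "1 \<le> j" "j \<le> k" "j \<le> ?B (Suc x)"
        have "\<beta> j \<le> Suc (\<alpha> j)" using R j by blast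
        then show "j \<le> ?A x" using A[OF j(1,2), of x] B[OF j(1,2), of "Suc x"] j by linarith
      qed
    qed
  qed
  finally show ?thesis .
qed

lemma count_ge_complement:
  assumes "X \<subseteq> {..<N}"
  shows "count_ge ({..<N} - X) x + count_ge X x = N - x"
proof -
  have "finite X" using assms finite_subset by blast
  then have "card ({c \<in> {..<N} - X. x \<le> c} \<union> {c \<in> X. x \<le> c}) = count_ge ({..<N} - X) x + count_ge X x"
    unfolding count_ge_def by (intro card_Un_disjoint) auto
  moreover have "{c \<in> {..<N} - X. x \<le> c} \<union> {c \<in> X. x \<le> c} = {x..<N}" using assms by auto
  ultimately show ?thesis by simp
qed

text \<open>Passing to complements reverses the inequalities between the counting functions. For Maya diagrams
  with elements \<open>a\<^sub>1 > a\<^sub>2 > \<dots>\<close> and \<open>b\<^sub>1 > b\<^sub>2 > \<dots>\<close> they now say \<open>b\<^sub>1 > a\<^sub>1 \<ge> b\<^sub>2 > a\<^sub>2 \<ge> \<dots>\<close>, which is the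
  interlacing of the partitions.\<close>

lemma horizontal_shift_matching_iff:
  assumes \<alpha>: "\<alpha> \<in> partition_parts k" and \<beta>: "\<beta> \<in> partition_parts (Suc k)"
    and sub: "maya k \<alpha> \<subseteq> {..<N}" "maya (Suc k) \<beta> \<subseteq> {..<Suc N}"
  shows "(\<exists>f. shift_matching f ({..<N} - maya k \<alpha>) ({..<Suc N} - maya (Suc k) \<beta>)) \<longleftrightarrow>
    (\<forall>j\<ge>1. \<alpha> j \<le> \<beta> j \<and> \<beta> (Suc j) \<le> \<alpha> j)" (is "?L \<longleftrightarrow> ?R")
proof -
  let ?A = "count_ge (maya k \<alpha>)" and ?B = "count_ge (maya (Suc k) \<beta>)"
  note A = count_ge_maya_iff[OF \<alpha>] and B = count_ge_maya_iff[OF \<beta>]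
  have "card ({..<N} - maya k \<alpha>) = card ({..<Suc N} - maya (Suc k) \<beta>)"
    using sub \<alpha> \<beta> by (simp add: card_Diff_subset card_maya)
  then have "?L \<longleftrightarrow> (\<forall>x. count_ge ({..<N} - maya k \<alpha>) x \<le> count_ge ({..<Suc N} - maya (Suc k) \<beta>) x \<and>
      count_ge ({..<Suc N} - maya (Suc k) \<beta>) (Suc x) \<le> count_ge ({..<N} - maya k \<alpha>) x)"
    by (simp add: shift_matching_exists_iff)
  also have "\<dots> \<longleftrightarrow> (\<forall>x. ?B x \<le> Suc (?A x) \<and> ?A x \<le> ?B (Suc x))"
  proof (rule iff_allI)
    fix x
    show "count_ge ({..<N} - maya k \<alpha>) x \<le> count_ge ({..<Suc N} - maya (Suc k) \<beta>) x \<and>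
      count_ge ({..<Suc N} - maya (Suc k) \<beta>) (Suc x) \<le> count_ge ({..<N} - maya k \<alpha>) x \<longleftrightarrow>
      ?B x \<le> Suc (?A x) \<and> ?A x \<le> ?B (Suc x)"
      using count_ge_complement[OF sub(1), of x] count_ge_complement[OF sub(2), of x]
        count_ge_complement[OF sub(2), of "Suc x"]
      by linarith
  qed
  also have "\<dots> \<longleftrightarrow> ?R"
  proof
    assume L: "\<forall>x. ?B x \<le> Suc (?A x) \<and> ?A x \<le> ?B (Suc x)"
    show ?R
    proof (intro allI impI)
      fix j :: nat assume j: "1 \<le> j"
      show "\<alpha> j \<le> \<beta> j \<and> \<beta> (Suc j) \<le> \<alpha> j"
      proof (cases "j \<le> k")
        case True
        let ?a = "\<alpha> j + k - j" and ?b = "\<beta> (Suc j) + Suc k - Suc j"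
        have Suc_j: "1 \<le> Suc j" "Suc j \<le> Suc k" using True by auto
        have "j \<le> ?A ?a" using A[OF j True] by blast
        then have "j \<le> ?B (Suc ?a)" using L le_trans by blast
        then have "Suc ?a \<le> \<beta> j + Suc k - j" using B[of j] j True by simp
        then have "\<alpha> j \<le> \<beta> j" using True by linarith
        have "Suc j \<le> ?B ?b" using B[OF Suc_j] by blast
        moreover have "?B ?b \<le> Suc (?A ?b)" using L by blast
        ultimately have "j \<le> ?A ?b" by linarith
        then have "?b \<le> ?a" using A[OF j True] by blast
        with \<open>\<alpha> j \<le> \<beta> j\<close> show ?thesis using True by linarith
      next
        case False
        then show ?thesis using \<alpha> \<beta> by (simp add: partition_parts_def)
      qed
    qed
  next
    assume R: ?R
    show "\<forall>x. ?B x \<le> Suc (?A x) \<and> ?A x \<le> ?B (Suc x)"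
    proof (intro allI conjI)
      fix x
      show "?B x \<le> Suc (?A x)"
      proof (rule le_via_thresholds[OF count_ge_maya_le[OF \<beta>]])
        fix j assume j: "1 \<le> j" "j \<le> Suc k" "j \<le> ?B x"
        show "j \<le> Suc (?A x)"
        proof (cases "j = 1")
          case False
          then obtain i where i: "j = Suc i" "1 \<le> i" "i \<le> k" using j by (cases j) auto
          have "\<beta> (Suc i) \<le> \<alpha> i" using R i by blast
          then show ?thesis using A[OF i(2,3), of x] B[OF j(1,2), of x] j i by simp
        qed simp
      qed
      show "?A x \<le> ?B (Suc x)"
      proof (rule le_via_thresholds[OF count_ge_maya_le[OF \<alpha>]])
        fix j assume j: "1 \<le> j" "j \<le> k" "j \<le> ?A x"
        have "\<alpha> j \<le> \<beta> j" using R j by blast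
        then show "j \<le> ?B (Suc x)" using A[OF j(1,2), of x] B[of j "Suc x"] j by linarith
      qed
    qed
  qed
  finally show ?thesis .
qed

lemma maya_bounded:
  assumes "\<nu> \<in> partition_parts k" "\<nu> 1 \<le> m"
  shows "maya k \<nu> \<subseteq> {..<m + k}"
proof
  fix c assume "c \<in> maya k \<nu>"
  then obtain j where j: "1 \<le> j" "j \<le> k" "c = \<nu> j + k - j" by (auto simp: maya_def)
  have "\<nu> j \<le> \<nu> 1" using assms(1) j by (simp add: partition_parts_def is_partition_def)
  then show "c \<in> {..<m + k}" using assms(2) j by simp
qed

section \<open>Tilings of the generalized Aztec triangle\<close>

text \<open>The number of squares of diagonal \<open>d\<close>, including, on the last diagonal, the positions that the
  triangle omits.\<close>

definition level_width :: "(nat \<Rightarrow> nat) \<Rightarrow> nat \<Rightarrow> nat" where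
  "level_width \<mu> d = \<mu> 1 + (d + 1) div 2"

definition triangle_level :: "nat \<Rightarrow> (nat \<Rightarrow> nat) \<Rightarrow> nat \<Rightarrow> nat set" where
  "triangle_level n \<mu> d =
     (if Suc d < 2 * n then {..<level_width \<mu> d}
      else if Suc d = 2 * n then {..<level_width \<mu> d} - maya n \<mu> else {})"

text \<open>The arrays whose Maya diagrams fit into the diagonals of the triangle, without any condition on
  consecutive rows. On them \<open>upward_sets\<close> below is injective, and the strip conditions become the
  matching conditions.\<close>

definition bounded_arrays :: "nat \<Rightarrow> (nat \<Rightarrow> nat) \<Rightarrow> (nat \<Rightarrow> nat \<Rightarrow> nat) set" where
  "bounded_arrays n \<mu> = {\<Lambda> \<in> extensional {0..<2 * n}. \<Lambda> (2 * n - 1) = \<mu> \<and>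
     (\<forall>d<2 * n. \<Lambda> d \<in> partition_parts ((d + 1) div 2) \<and>
        maya ((d + 1) div 2) (\<Lambda> d) \<subseteq> {..<level_width \<mu> d})}"

text \<open>On odd diagonals the Maya diagram marks the squares joined upwards, on even ones those joined
  downwards. No square of the last diagonal \<open>2 n - 1\<close> is joined upwards.\<close>

definition upward_sets :: "nat \<Rightarrow> (nat \<Rightarrow> nat) \<Rightarrow> (nat \<Rightarrow> nat \<Rightarrow> nat) \<Rightarrow> nat \<Rightarrow> nat set" where
  "upward_sets n \<mu> \<Lambda> d =
     (if Suc d < 2 * n then
        if odd d then maya ((d + 1) div 2) (\<Lambda> d) else {..<level_width \<mu> d} - maya ((d + 1) div 2) (\<Lambda> d)
      else {})"

lemma level_width_simps [simp]:
  "level_width \<mu> (2 * k) = \<mu> 1 + k"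
  "level_width \<mu> (Suc (2 * k)) = Suc (\<mu> 1 + k)"
  by (simp_all add: level_width_def)

lemma aztec_triangle1_eq_region:
  assumes "n \<ge> 1"
  shows "aztec_triangle1 n \<mu> = region (level_cells (triangle_level n \<mu>))"
proof -
  have "p \<in> aztec_triangle1 n \<mu> \<longleftrightarrow> (\<exists>c d. c \<in> triangle_level n \<mu> d \<and> p \<in> aztec_square c d)" for p
  proof -
    have low: "d \<le> 2 * n - 2 \<and> int c < int (\<mu> 1) + \<lceil>real d / 2\<rceil> \<longleftrightarrow> Suc d < 2 * n \<and> c \<in> triangle_level n \<mu> d" for c d
      using assms by (auto simp: triangle_level_def level_width_def ceiling_half)
    have top: "c \<in> {0..<\<mu> 1 + n} - {\<mu> j + n - j |j. 1 \<le> j \<and> j \<le> n} \<longleftrightarrow> c \<in> triangle_level n \<mu> (2 * n - 1)" for c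
      using assms by (auto simp: triangle_level_def level_width_def maya_def)
    have split: "c \<in> triangle_level n \<mu> d \<longleftrightarrow>
        (Suc d < 2 * n \<and> c \<in> triangle_level n \<mu> d) \<or> (d = 2 * n - 1 \<and> c \<in> triangle_level n \<mu> (2 * n - 1))" for c d
      using assms by (cases "d = 2 * n - 1") (auto simp: triangle_level_def)
    have "p \<in> aztec_triangle1 n \<mu> \<longleftrightarrow> (\<exists>c d. (Suc d < 2 * n \<and> c \<in> triangle_level n \<mu> d) \<and> p \<in> aztec_square c d) \<or>
        (\<exists>c. c \<in> triangle_level n \<mu> (2 * n - 1) \<and> p \<in> aztec_square c (2 * n - 1))"
      unfolding aztec_triangle1_def low top by blast
    also have "\<dots> \<longleftrightarrow> (\<exists>c d. c \<in> triangle_level n \<mu> d \<and> p \<in> aztec_square c d)"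
      using split by blast
    finally show ?thesis .
  qed
  moreover have "p \<in> region (level_cells C) \<longleftrightarrow> (\<exists>c d. c \<in> C d \<and> p \<in> aztec_square c d)" for p C
  proof
    assume "p \<in> region (level_cells C)"
    then show "\<exists>c d. c \<in> C d \<and> p \<in> aztec_square c d"
      by (auto simp: in_region_iff level_cells_def corner_def aztec_square_def)
  next
    assume "\<exists>c d. c \<in> C d \<and> p \<in> aztec_square c d"
    then obtain c d where "c \<in> C d" "p \<in> aztec_square c d" by blast
    then show "p \<in> region (level_cells C)"
      unfolding in_region_iff aztec_square_def by (metis corner_def corner_in_level_cells)
  qed
  ultimately show ?thesis by blast
qed

context
  fixes n :: nat and \<mu> :: "nat \<Rightarrow> nat"
  assumes n: "n \<ge> 1" and \<mu>: "\<mu> \<in> partition_parts n"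
begin

lemma case1_subset_bounded_arrays: "case1_sequences (2 * n) \<mu> \<subseteq> bounded_arrays n \<mu>"
proof
  fix \<Lambda> assume L: "\<Lambda> \<in> case1_sequences (2 * n) \<mu>"
  have parts: "\<Lambda> d \<in> partition_parts ((d + 1) div 2)" if "d < 2 * n" for d
    using L that L[unfolded case1_sequences_iff[OF n]]
    by (auto simp: partition_parts_def case1_sequences_def)
  have "maya ((d + 1) div 2) (\<Lambda> d) \<subseteq> {..<level_width \<mu> d}" if "d < 2 * n" for d
  proof -
    have "young (\<Lambda> d) \<subseteq> young \<mu>"
      using case1_sequences_mono[OF L, of d "2 * n - 1"] that n L by (simp add: case1_sequences_def)
    then have "\<Lambda> d 1 \<le> \<mu> 1" by (simp add: young_subset_iff)
    then show ?thesis unfolding level_width_def by (rule maya_bounded[OF parts[OF that]])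
  qed
  then show "\<Lambda> \<in> bounded_arrays n \<mu>"
    using L parts by (simp add: bounded_arrays_def case1_sequences_def PiE_def)
qed

text \<open>On the last diagonal the Maya diagram of \<open>\<mu>\<close> is missing from the triangle; on the other odd diagonals
  the Maya diagram is joined upwards. Either way the same set remains.\<close>

lemma downward_set_of_odd_level:
  assumes "\<Lambda> \<in> bounded_arrays n \<mu>" "k < n"
  shows "triangle_level n \<mu> (Suc (2 * k)) - upward_sets n \<mu> \<Lambda> (Suc (2 * k)) =
    {..<Suc (\<mu> 1 + k)} - maya (Suc k) (\<Lambda> (Suc (2 * k)))"
proof (cases "Suc k = n")
  case True
  then have "\<Lambda> (Suc (2 * k)) = \<mu>"
    using assms(1) by (auto simp: bounded_arrays_def)
  then show ?thesis using True by (auto simp: triangle_level_def upward_sets_def)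
next
  case False
  then show ?thesis using assms(2) by (auto simp: triangle_level_def upward_sets_def)
qed

text \<open>The steps out of even diagonals move the complements of Maya diagrams and are the horizontal
  strips; the steps out of odd diagonals move the Maya diagrams and are the vertical strips.\<close>

lemma upward_sets_iff:
  assumes L: "\<Lambda> \<in> bounded_arrays n \<mu>"
  shows "upward_sets n \<mu> \<Lambda> \<in> upward_sequences (triangle_level n \<mu>) \<longleftrightarrow> \<Lambda> \<in> case1_sequences (2 * n) \<mu>"
proof -
  let ?U = "upward_sets n \<mu> \<Lambda>" and ?C = "triangle_level n \<mu>"
  let ?step = "\<lambda>d. \<exists>f. shift_matching f (?U d) (?C (Suc d) - ?U (Suc d))"
  have parts: "\<Lambda> d \<in> partition_parts ((d + 1) div 2)" and
    bound: "maya ((d + 1) div 2) (\<Lambda> d) \<subseteq> {..<level_width \<mu> d}" if "d < 2 * n" for d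
    using L that by (auto simp: bounded_arrays_def)
  have zero: "\<Lambda> 0 = (\<lambda>_. 0)"
    using parts[of 0] n by (auto simp: partition_parts_def is_partition_def fun_eq_iff) (metis gr0I)
  have first: "?U 0 = ?C 0"
    using n by (simp add: upward_sets_def triangle_level_def maya_def)
  have sub: "?U d \<subseteq> ?C d" for d
    using bound[of d] by (auto simp: upward_sets_def triangle_level_def)
  have even: "?step (2 * k) \<longleftrightarrow>
      (\<forall>j\<ge>1. \<Lambda> (2 * k) j \<le> \<Lambda> (2 * k + 1) j \<and> \<Lambda> (2 * k + 1) (Suc j) \<le> \<Lambda> (2 * k) j)" if k: "k < n" for k
  proof -
    have "?U (2 * k) = {..<\<mu> 1 + k} - maya k (\<Lambda> (2 * k))"
      using k by (simp add: upward_sets_def)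
    then show ?thesis
      using horizontal_shift_matching_iff[of "\<Lambda> (2 * k)" k "\<Lambda> (Suc (2 * k))" "\<mu> 1 + k"]
        downward_set_of_odd_level[OF L k] parts[of "2 * k"] parts[of "Suc (2 * k)"]
        bound[of "2 * k"] bound[of "Suc (2 * k)"] k
      by simp
  qed
  have odd: "?step (2 * k + 1) \<longleftrightarrow> (\<forall>j\<ge>1. \<Lambda> (2 * k + 1) j \<le> \<Lambda> (2 * k + 2) j \<and>
      \<Lambda> (2 * k + 2) j \<le> Suc (\<Lambda> (2 * k + 1) j))" if k: "k + 1 < n" for k
  proof -
    have "?U (2 * k + 1) = maya (Suc k) (\<Lambda> (2 * k + 1))"
      using k by (simp add: upward_sets_def)
    moreover have "?C (Suc (2 * k + 1)) - ?U (Suc (2 * k + 1)) = maya (Suc k) (\<Lambda> (2 * k + 2))"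
      using k bound[of "2 * k + 2"] by (auto simp: upward_sets_def triangle_level_def)
    ultimately show ?thesis
      using vertical_shift_matching_iff[of "\<Lambda> (2 * k + 1)" "Suc k" "\<Lambda> (2 * k + 2)"]
        parts[of "2 * k + 1"] parts[of "2 * k + 2"] k
      by simp
  qed
  have beyond: "?step d" if "2 * n \<le> Suc d" for d
    using that by (intro exI[of _ id]) (auto simp: shift_matching_def bij_betw_def upward_sets_def triangle_level_def)
  have "(\<forall>d. ?step d) \<longleftrightarrow> (\<forall>k<n. ?step (2 * k)) \<and> (\<forall>k. k + 1 < n \<longrightarrow> ?step (2 * k + 1))"
  proof (intro iffI conjI allI impI)
    fix d assume steps: "(\<forall>k<n. ?step (2 * k)) \<and> (\<forall>k. k + 1 < n \<longrightarrow> ?step (2 * k + 1))"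
    show "?step d"
    proof (cases "2 * n \<le> Suc d")
      case False
      show ?thesis
      proof (cases "even d")
        case True
        then obtain k where "d = 2 * k" ..
        then show ?thesis using steps False by simp
      next
        case False
        then obtain k where k: "d = 2 * k + 1" ..
        then have "k + 1 < n" using \<open>\<not> 2 * n \<le> Suc d\<close> by simp
        then show ?thesis using steps k by blast
      qed
    qed (rule beyond)
  qed auto
  moreover have "?U \<in> upward_sequences ?C \<longleftrightarrow> (\<forall>d. ?step d)"
    using first sub by (simp add: upward_sequences_def)
  moreover have "\<Lambda> \<in> case1_sequences (2 * n) \<mu> \<longleftrightarrow>
      (\<forall>k<n. ?step (2 * k)) \<and> (\<forall>k. k + 1 < n \<longrightarrow> ?step (2 * k + 1))"
  proof -
    have "\<Lambda> \<in> extensional {0..<2 * n} \<and> \<Lambda> 0 = (\<lambda>_. 0) \<and> \<Lambda> (2 * n - 1) = \<mu> \<and>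
        (\<forall>d<2 * n. \<Lambda> d 0 = 0 \<and> (\<forall>j>(d + 1) div 2. \<Lambda> d j = 0))"
      using L zero parts by (auto simp: bounded_arrays_def partition_parts_def is_partition_def)
    then show ?thesis
      unfolding case1_sequences_iff[OF n] using even odd by auto
  qed
  ultimately show ?thesis by blast
qed

lemma inj_on_upward_sets: "inj_on (upward_sets n \<mu>) (bounded_arrays n \<mu>)"
proof (intro inj_onI, rule ext)
  fix \<Lambda> \<Lambda>' d
  assume L: "\<Lambda> \<in> bounded_arrays n \<mu>" "\<Lambda>' \<in> bounded_arrays n \<mu>"
    and eq: "upward_sets n \<mu> \<Lambda> = upward_sets n \<mu> \<Lambda>'"
  consider "Suc d < 2 * n" | "Suc d = 2 * n" | "2 * n \<le> d" by linarith
  then show "\<Lambda> d = \<Lambda>' d"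
  proof cases
    case 1
    let ?k = "(d + 1) div 2"
    have parts: "\<Lambda> d \<in> partition_parts ?k" "\<Lambda>' d \<in> partition_parts ?k"
      and bound: "maya ?k (\<Lambda> d) \<subseteq> {..<level_width \<mu> d}" "maya ?k (\<Lambda>' d) \<subseteq> {..<level_width \<mu> d}"
      using L 1 by (auto simp: bounded_arrays_def)
    have "maya ?k (\<Lambda> d) = maya ?k (\<Lambda>' d)"
      using fun_cong[OF eq, of d] 1 bound by (auto simp: upward_sets_def split: if_splits)
    with parts show ?thesis by (rule maya_inject)
  next
    case 2
    then have "d = 2 * n - 1" by simp
    then show ?thesis using L by (simp add: bounded_arrays_def)
  next
    case 3
    then show ?thesis using L by (simp add: bounded_arrays_def extensional_def)
  qed
qed

text \<open>The sets \<open>X d\<close> that should be Maya diagrams are read off from \<open>U\<close>. The matchings preserve cardinality,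
  so going up the diagonals shows that \<open>X d\<close> has \<open>(d + 1) div 2\<close> elements; hence it is a Maya diagram of
  a partition with that many parts.\<close>

lemma upward_sequences_subset: "upward_sequences (triangle_level n \<mu>) \<subseteq> upward_sets n \<mu> ` bounded_arrays n \<mu>"
proof
  fix U assume U: "U \<in> upward_sequences (triangle_level n \<mu>)"
  let ?C = "triangle_level n \<mu>" and ?N = "level_width \<mu>"
  define X where "X d = (if Suc d = 2 * n then maya n \<mu> else if odd d then U d else {..<?N d} - U d)" for d
  have first: "U 0 = ?C 0" and sub: "\<And>d. U d \<subseteq> ?C d"
    and step: "\<And>d. \<exists>f. shift_matching f (U d) (?C (Suc d) - U (Suc d))"
    using U by (auto simp: upward_sequences_def)
  have U_bound: "U d \<subseteq> {..<?N d}" if "d < 2 * n" for d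
    using sub[of d] that by (auto simp: triangle_level_def split: if_splits)
  have U_top: "U d = {}" if "2 * n \<le> Suc d" for d
  proof -
    obtain f where "shift_matching f (U d) (?C (Suc d) - U (Suc d))" using step by blast
    then show ?thesis using that by (auto simp: shift_matching_def bij_betw_def triangle_level_def)
  qed
  have \<mu>_bound: "maya n \<mu> \<subseteq> {..<?N d}" if "Suc d = 2 * n" for d
    using maya_bounded[OF \<mu> order_refl] that by (simp add: level_width_def)
  have X_bound: "X d \<subseteq> {..<?N d}" if "d < 2 * n" for d
    using U_bound[OF that] \<mu>_bound[of d] by (auto simp: X_def)
  have card_step: "card (U d) = card (?C (Suc d) - U (Suc d))" for d
    using step[of d] by (auto simp: shift_matching_def dest: bij_betw_same_card)
  have up_even: "U (2 * k) = {..<?N (2 * k)} - X (2 * k)" if "k < n" for k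
  proof -
    have "Suc (2 * k) \<noteq> 2 * n" by presburger
    then show ?thesis using U_bound[of "2 * k"] that by (auto simp: X_def)
  qed
  have down_odd: "?C (Suc (2 * k)) - U (Suc (2 * k)) = {..<?N (Suc (2 * k))} - X (Suc (2 * k))" if "k < n" for k
    using that U_top[of "Suc (2 * k)"] by (auto simp: X_def triangle_level_def)
  have up_odd: "U (Suc (2 * k)) = X (Suc (2 * k))" if "Suc k < n" for k
    using that by (auto simp: X_def)
  have down_even: "?C (Suc (Suc (2 * k))) - U (Suc (Suc (2 * k))) = X (Suc (Suc (2 * k)))" if "Suc k < n" for k
  proof -
    have "Suc (Suc (Suc (2 * k))) \<noteq> 2 * n" by presburger
    then show ?thesis using that by (auto simp: X_def triangle_level_def)
  qed
  have card_complement: "card ({..<?N d} - X d) + card (X d) = ?N d" if "d < 2 * n" for d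
  proof -
    have "finite (X d)" using X_bound[OF that] finite_subset by blast
    then show ?thesis
      using card_Diff_subset[OF _ X_bound[OF that]] card_mono[OF _ X_bound[OF that]] by simp
  qed
  have card_odd: "card (X (Suc (2 * k))) = Suc k" if "k < n" "card (X (2 * k)) = k" for k
    using card_step[of "2 * k"] card_complement[of "2 * k"] card_complement[of "Suc (2 * k)"] that
    by (simp add: up_even down_odd)
  have card_even: "card (X (2 * k)) = k" if "k < n" for k
    using that
  proof (induction k)
    case 0
    have "X 0 = {}" using first n by (auto simp: X_def triangle_level_def)
    then show ?case by simp
  next
    case (Suc k)
    then have "card (X (Suc (2 * k))) = Suc k" by (simp add: card_odd)
    then have "card (X (Suc (Suc (2 * k)))) = Suc k"
      using card_step[of "Suc (2 * k)"] Suc.prems by (simp add: up_odd down_even)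
    then show ?case by simp
  qed
  have card_X: "card (X d) = (d + 1) div 2" if "d < 2 * n" for d
  proof (cases "even d")
    case True
    then obtain k where "d = 2 * k" ..
    then show ?thesis using card_even that by simp
  next
    case False
    then obtain k where "d = 2 * k + 1" ..
    then show ?thesis using card_odd[OF _ card_even, of k] that by simp
  qed
  have "\<exists>\<nu>. d < 2 * n \<longrightarrow> \<nu> \<in> partition_parts ((d + 1) div 2) \<and> maya ((d + 1) div 2) \<nu> = X d" for d
  proof (cases "d < 2 * n")
    case True
    have "finite (X d)" using X_bound[OF True] finite_subset by blast
    then show ?thesis using maya_surj[OF _ card_X[OF True]] by blast
  qed simp
  then obtain \<Lambda>0 where L0: "\<And>d. d < 2 * n \<Longrightarrow> \<Lambda>0 d \<in> partition_parts ((d + 1) div 2)"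
    "\<And>d. d < 2 * n \<Longrightarrow> maya ((d + 1) div 2) (\<Lambda>0 d) = X d"
    by metis
  define \<Lambda> where "\<Lambda> = restrict \<Lambda>0 {0..<2 * n}"
  have L: "\<Lambda> d \<in> partition_parts ((d + 1) div 2)" "maya ((d + 1) div 2) (\<Lambda> d) = X d" if "d < 2 * n" for d
    using L0[OF that] that by (simp_all add: \<Lambda>_def)
  have "\<Lambda> (2 * n - 1) = \<mu>"
  proof (rule maya_inject[of _ n])
    show "\<Lambda> (2 * n - 1) \<in> partition_parts n" "maya n (\<Lambda> (2 * n - 1)) = maya n \<mu>"
      using L[of "2 * n - 1"] n by (simp_all add: X_def)
  qed (rule \<mu>)
  then have "\<Lambda> \<in> bounded_arrays n \<mu>"
    using L X_bound by (simp add: bounded_arrays_def \<Lambda>_def)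
  moreover have "upward_sets n \<mu> \<Lambda> = U"
  proof
    fix d
    show "upward_sets n \<mu> \<Lambda> d = U d"
    proof (cases "Suc d < 2 * n")
      case True
      then show ?thesis using L(2)[of d] U_bound[of d] by (auto simp: upward_sets_def X_def)
    next
      case False
      then show ?thesis using U_top[of d] by (simp add: upward_sets_def)
    qed
  qed
  ultimately show "U \<in> upward_sets n \<mu> ` bounded_arrays n \<mu>" by blast
qed

lemma bij_betw_upward_sets:
  "bij_betw (upward_sets n \<mu>) (case1_sequences (2 * n) \<mu>) (upward_sequences (triangle_level n \<mu>))"
proof (intro bij_betw_imageI equalityI subsetI)
  show "inj_on (upward_sets n \<mu>) (case1_sequences (2 * n) \<mu>)"
    using inj_on_upward_sets case1_subset_bounded_arrays by (rule inj_on_subset)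
next
  fix U assume "U \<in> upward_sets n \<mu> ` case1_sequences (2 * n) \<mu>"
  then show "U \<in> upward_sequences (triangle_level n \<mu>)"
    using upward_sets_iff case1_subset_bounded_arrays by blast
next
  fix U assume U: "U \<in> upward_sequences (triangle_level n \<mu>)"
  then obtain \<Lambda> where "\<Lambda> \<in> bounded_arrays n \<mu>" "U = upward_sets n \<mu> \<Lambda>"
    using upward_sequences_subset by blast
  with U show "U \<in> upward_sets n \<mu> ` case1_sequences (2 * n) \<mu>"
    using upward_sets_iff by blast
qed

end

section \<open>The four sets\<close>

theorem theorem3p11:
  fixes n :: nat and \<mu> :: "nat \<Rightarrow> nat"
  assumes "n \<ge> 1"
    and "is_partition \<mu>"
    and "\<forall>j>n. \<mu> j = 0"
  shows "finite (case1_sequences (2 * n) \<mu>) \<and>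
    finite (tableaux_with_entries_less (Barred n) \<mu>) \<and>
    finite (nonintersecting_delannoy_tuples n \<mu>) \<and>
    finite (domino_tilings (aztec_triangle1 n \<mu>)) \<and>
    (\<exists>f. bij_betw f (case1_sequences (2 * n) \<mu>)
        (tableaux_with_entries_less (Barred n) \<mu>)) \<and>
    (\<exists>f. bij_betw f (tableaux_with_entries_less (Barred n) \<mu>)
        (nonintersecting_delannoy_tuples n \<mu>)) \<and>
    (\<exists>f. bij_betw f (nonintersecting_delannoy_tuples n \<mu>)
        (domino_tilings (aztec_triangle1 n \<mu>)))"
proof -
  let ?S = "case1_sequences (2 * n) \<mu>" and ?T = "tableaux_with_entries_less (Barred n) \<mu>"
  let ?P = "nonintersecting_delannoy_tuples n \<mu>" and ?D = "domino_tilings (aztec_triangle1 n \<mu>)"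
  let ?C = "triangle_level n \<mu>"
  have \<mu>: "\<mu> \<in> partition_parts n" "\<mu> 0 = 0"
    using assms by (simp_all add: partition_parts_def is_partition_def)
  have ST: "bij_betw (tableau_of \<mu>) ?S ?T" using assms(1,2) by (rule bij_betw_tableau_of)
  have SP: "bij_betw (paths_of n) ?S ?P" using assms(1) \<mu>(2) assms(3) by (rule bij_betw_paths_of)
  have "bij_betw (the_inv_into (cell_tilings (level_cells ?C)) upward \<circ> upward_sets n \<mu>) ?S
      (cell_tilings (level_cells ?C))"
    using bij_betw_upward_sets[OF assms(1) \<mu>(1)] bij_betw_the_inv_into[OF bij_betw_upward] by (rule bij_betw_trans)
  moreover have "bij_betw (image region) (cell_tilings (level_cells ?C)) ?D"
    unfolding aztec_triangle1_eq_region[OF assms(1)] by (rule bij_betw_cell_tilings)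
  ultimately obtain g where SD: "bij_betw g ?S ?D" using bij_betw_trans by blast
  have "finite ?T" using assms(2) by (rule finite_tableaux_with_entries_less)
  then have "finite ?S" using bij_betw_finite[OF ST] by blast
  then have "finite ?P" "finite ?D" using bij_betw_finite[OF SP] bij_betw_finite[OF SD] by blast+
  moreover have "\<exists>f. bij_betw f ?T ?P" "\<exists>f. bij_betw f ?P ?D"
    using bij_betw_trans[OF bij_betw_the_inv_into[OF ST] SP]
      bij_betw_trans[OF bij_betw_the_inv_into[OF SP] SD] by blast+
  ultimately show ?thesis using ST \<open>finite ?T\<close> \<open>finite ?S\<close> by blast
qed

end
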